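(* Let $A\subset\mathbb{R}^d$ be nonempty and compact and let $r_0>0$ be a differentiability point of the function $r\mapsto V_A(r)$ on $(0,\infty)$. Then the measures $S_A(r,\cdot)$ converge weakly to $S_A(r_0,\cdot)$ as $r\to r_0$.
   Context: For nonempty compact $A\subset\mathbb{R}^d$ and $r>0$, the open $r$-parallel set is $A_r:=\{x\in\mathbb{R}^d: d(x,A)<r\}$, where $d(x,A)=\min_{y\in A}|x-y|$. The volume function of $A$ is $V_A(r):=\lambda_d(A_r)$, $r>0$, where $\lambda_d$ is Lebesgue measure on $\mathbb{R}^d$. The parallel surface measure of $A$ at distance $r$ is the Borel measure $S_A(r,\cdot):=\mathcal{H}^{d-1}(\partial A_r\cap\cdot)$ on $\mathbb{R}^d$, where $\mathcal{H}^{d-1}$ is $(d-1)$-dimensional Hausdorff measure and $\partial A_r$ is the topological boundary of $A_r$. Weak convergence of finite Borel measures means convergence of integrals of all bounded continuous functions. *)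

theory Defs
  imports "HOL-Analysis.Analysis"
begin

section \<open>Hausdorff measure\<close>

text \<open>
  The constant is the usual one, \<open>\<omega>\<^sub>s / 2 ^ s\<close>, where \<open>\<omega>\<^sub>s\<close> is the volume of the
  \<open>s\<close>-dimensional unit ball. As \<open>0 ^ 0 = 1\<close>, every nonempty set has weight 1 for \<open>s = 0\<close>,
  so that zero-dimensional Hausdorff measure is counting measure; the empty set must be
  given weight 0 separately.
\<close>

definition hausdorff_weight :: "nat \<Rightarrow> 'a::metric_space set \<Rightarrow> ennreal" where
  "hausdorff_weight s U =
     (if U = {} then 0 else ennreal (unit_ball_vol (real s) * (diameter U / 2) ^ s))"

text \<open>
  Boundedness has to be required of the covering sets, since \<^const>\<open>diameter\<close> is
  meaningless on unbounded sets. Covers by fewer sets arise by padding with \<open>{}\<close>.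
\<close>

definition hausdorff_covers :: "real \<Rightarrow> 'a::metric_space set \<Rightarrow> (nat \<Rightarrow> 'a set) set" where
  "hausdorff_covers \<delta> E = {U. E \<subseteq> (\<Union>i. U i) \<and> (\<forall>i. bounded (U i) \<and> diameter (U i) \<le> \<delta>)}"

definition hausdorff_content :: "nat \<Rightarrow> real \<Rightarrow> 'a::metric_space set \<Rightarrow> ennreal" where
  "hausdorff_content s \<delta> E = (INF U\<in>hausdorff_covers \<delta> E. \<Sum>i. hausdorff_weight s (U i))"

definition hausdorff_outer :: "nat \<Rightarrow> 'a::metric_space set \<Rightarrow> ennreal" where
  "hausdorff_outer s E = (SUP \<delta>\<in>{0<..}. hausdorff_content s \<delta> E)"

definition hausdorff_measure :: "nat \<Rightarrow> 'a::metric_space measure" where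
  "hausdorff_measure s = measure_of UNIV (sets borel) (hausdorff_outer s)"

text \<open>
  \<^const>\<open>measure_of\<close> yields the zero measure unless the given set function is countably
  additive. The following lemmas (Caratheodory's criterion) show that this does not happen.
\<close>

lemma hausdorff_weight_mono:
  assumes "U \<subseteq> V" "bounded V"
  shows "hausdorff_weight s U \<le> hausdorff_weight s V"
  using assms diameter_subset[OF assms] diameter_ge_0[OF bounded_subset[OF assms(2,1)]]
  by (auto simp: hausdorff_weight_def intro!: ennreal_leI mult_left_mono power_mono)

lemma hausdorff_content_le:
  "U \<in> hausdorff_covers \<delta> E \<Longrightarrow> hausdorff_content s \<delta> E \<le> (\<Sum>i. hausdorff_weight s (U i))"
  unfolding hausdorff_content_def by (rule INF_lower)

lemma hausdorff_content_mono:
  "E \<subseteq> F \<Longrightarrow> hausdorff_content s \<delta> E \<le> hausdorff_content s \<delta> F"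
  unfolding hausdorff_content_def
  by (rule INF_superset_mono) (auto simp: hausdorff_covers_def)

lemma hausdorff_content_antimono:
  "\<delta> \<le> \<delta>' \<Longrightarrow> hausdorff_content s \<delta>' E \<le> hausdorff_content s \<delta> E"
  unfolding hausdorff_content_def
  by (rule INF_superset_mono) (auto simp: hausdorff_covers_def intro: order_trans)

lemma hausdorff_content_UN:
  "hausdorff_content s \<delta> (\<Union>n. A n) \<le> (\<Sum>n. hausdorff_content s \<delta> (A n))"
proof (cases "(\<Sum>n. hausdorff_content s \<delta> (A n)) = top")
  case False
  then have fin: "hausdorff_content s \<delta> (A n) < top" for n
    using sum_le_suminf[of "\<lambda>n. hausdorff_content s \<delta> (A n)" "{n}"]
    by (auto simp: less_top intro: le_less_trans)
  show ?thesis
  proof (rule ennreal_le_epsilon)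
    fix e :: real assume "0 < e"
    have "\<exists>U\<in>hausdorff_covers \<delta> (A n).
        (\<Sum>i. hausdorff_weight s (U i)) < hausdorff_content s \<delta> (A n) + ennreal (e * (1/2) ^ Suc n)" for n
    proof -
      have "hausdorff_content s \<delta> (A n) < hausdorff_content s \<delta> (A n) + ennreal (e * (1/2) ^ Suc n)"
        using fin[of n] \<open>0 < e\<close> by (simp add: ennreal_add_left_cancel_less[of _ 0, simplified])
      then show ?thesis
        by (subst (asm) (1) hausdorff_content_def) (simp add: INF_less_iff)
    qed
    then obtain U where U: "\<And>n. U n \<in> hausdorff_covers \<delta> (A n)"
      and le: "\<And>n. (\<Sum>i. hausdorff_weight s (U n i)) < hausdorff_content s \<delta> (A n) + ennreal (e * (1/2) ^ Suc n)"
      by metis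
    define W where "W = (\<lambda>i. case prod_decode i of (n, m) \<Rightarrow> U n m)"
    have "W \<in> hausdorff_covers \<delta> (\<Union>n. A n)"
    proof -
      have "A n \<subseteq> (\<Union>i. W i)" for n
      proof
        fix x assume "x \<in> A n"
        with U[of n] obtain m where "x \<in> U n m" by (auto simp: hausdorff_covers_def)
        then have "x \<in> W (prod_encode (n, m))" by (simp add: W_def)
        then show "x \<in> (\<Union>i. W i)" by blast
      qed
      then show ?thesis
        using U by (auto simp: hausdorff_covers_def W_def split: prod.split)
    qed
    then have "hausdorff_content s \<delta> (\<Union>n. A n) \<le> (\<Sum>i. hausdorff_weight s (W i))"
      by (rule hausdorff_content_le)
    also have "\<dots> = (\<Sum>i. (\<lambda>(n, m). hausdorff_weight s (U n m)) (prod_decode i))"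
      by (simp add: W_def case_prod_unfold)
    also have "\<dots> = (\<Sum>n. \<Sum>m. hausdorff_weight s (U n m))"
      by (rule suminf_ennreal_2dimen) simp
    also have "\<dots> \<le> (\<Sum>n. hausdorff_content s \<delta> (A n) + ennreal (e * (1/2) ^ Suc n))"
      using le by (intro suminf_le) (auto intro: less_imp_le)
    also have "\<dots> = (\<Sum>n. hausdorff_content s \<delta> (A n)) + (\<Sum>n. ennreal (e * (1/2) ^ Suc n))"
      by (rule suminf_add[symmetric]) auto
    also have "(\<Sum>n. ennreal (e * (1/2) ^ Suc n)) = ennreal e"
    proof (rule suminf_ennreal_eq)
      show "(\<lambda>n. e * (1/2) ^ Suc n) sums e"
        using sums_mult[OF power_half_series, of e] by simp
    qed (use \<open>0 < e\<close> in auto)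
    finally show "hausdorff_content s \<delta> (\<Union>n. A n) \<le> (\<Sum>n. hausdorff_content s \<delta> (A n)) + ennreal e" .
  qed
qed simp

lemma hausdorff_outer_empty [simp]: "hausdorff_outer s {} = 0"
proof -
  have "hausdorff_content s \<delta> {} = 0" if "0 < \<delta>" for \<delta>
    using hausdorff_content_le[of "\<lambda>_. {}" \<delta> "{}" s] that
    by (auto simp: hausdorff_covers_def hausdorff_weight_def)
  then have "hausdorff_outer s {} \<le> 0"
    unfolding hausdorff_outer_def by (intro SUP_least) simp
  then show ?thesis by simp
qed

lemma hausdorff_outer_mono: "E \<subseteq> F \<Longrightarrow> hausdorff_outer s E \<le> hausdorff_outer s F"
  unfolding hausdorff_outer_def by (intro SUP_mono) (auto intro: hausdorff_content_mono)

lemma hausdorff_outer_UN: "hausdorff_outer s (\<Union>n. A n) \<le> (\<Sum>n. hausdorff_outer s (A n))"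
proof -
  have "hausdorff_content s \<delta> (\<Union>n. A n) \<le> (\<Sum>n. hausdorff_outer s (A n))" if "0 < \<delta>" for \<delta>
  proof -
    note hausdorff_content_UN
    also have "(\<Sum>n. hausdorff_content s \<delta> (A n)) \<le> (\<Sum>n. hausdorff_outer s (A n))"
      using that by (intro suminf_le) (auto simp: hausdorff_outer_def intro: SUP_upper)
    finally show ?thesis .
  qed
  then show ?thesis by (auto simp: hausdorff_outer_def intro!: SUP_least)
qed

lemma hausdorff_outer_Un: "hausdorff_outer s (E \<union> F) \<le> hausdorff_outer s E + hausdorff_outer s F"
proof -
  have "hausdorff_outer s (\<Union>n::nat. (\<lambda>n. if n = 0 then E else if n = 1 then F else {}) n)
      \<le> (\<Sum>n. hausdorff_outer s ((\<lambda>n. if n = 0 then E else if n = 1 then F else {}) n))"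
    by (rule hausdorff_outer_UN)
  also have "(\<Union>n::nat. (\<lambda>n. if n = 0 then E else if n = 1 then F else {}) n) = E \<union> F"
    by (auto split: if_splits)
  also have "(\<Sum>n. hausdorff_outer s ((\<lambda>n. if n = 0 then E else if n = 1 then F else {}) n))
      = (\<Sum>n\<in>{0, 1::nat}. hausdorff_outer s ((\<lambda>n. if n = 0 then E else if n = 1 then F else {}) n))"
    by (rule suminf_finite) auto
  finally show ?thesis by simp
qed

lemma hausdorff_outer_separated:
  assumes "0 < \<eta>" and sep: "\<And>x y. x \<in> E \<Longrightarrow> y \<in> F \<Longrightarrow> \<eta> \<le> dist x y"
  shows "hausdorff_outer s E + hausdorff_outer s F \<le> hausdorff_outer s (E \<union> F)"
proof -
  have main: "hausdorff_content s \<delta> E + hausdorff_content s \<delta> F \<le> hausdorff_content s \<delta> (E \<union> F)"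
    if "\<delta> < \<eta>" for \<delta>
    unfolding hausdorff_content_def[of _ _ "E \<union> F"]
  proof (rule INF_greatest)
    fix U assume U: "U \<in> hausdorff_covers \<delta> (E \<union> F)"
    then have b: "bounded (U i)" and d: "diameter (U i) \<le> \<delta>" for i
      by (auto simp: hausdorff_covers_def)
    have sub: "(\<lambda>i. U i \<inter> G) \<in> hausdorff_covers \<delta> G" if "G = E \<or> G = F" for G
      using U that b d
      by (auto simp: hausdorff_covers_def intro: bounded_subset[OF b]
          order_trans[OF diameter_subset[OF _ b]])
    have "hausdorff_weight s (U i \<inter> E) + hausdorff_weight s (U i \<inter> F) \<le> hausdorff_weight s (U i)" for i
    proof (cases "U i \<inter> E = {} \<or> U i \<inter> F = {}")
      case True
      then show ?thesis
        using hausdorff_weight_mono[OF _ b[of i], of "U i \<inter> E" s] hausdorff_weight_mono[OF _ b[of i], of "U i \<inter> F" s]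
        by (auto simp: hausdorff_weight_def[of _ "{}"])
    next
      case False
      then obtain x y where "x \<in> U i" "x \<in> E" "y \<in> U i" "y \<in> F" by blast
      then have "\<eta> \<le> dist x y" "dist x y \<le> diameter (U i)"
        using sep diameter_bounded_bound[OF b] by auto
      then show ?thesis using d[of i] that by linarith
    qed
    then have "(\<Sum>i. hausdorff_weight s (U i \<inter> E) + hausdorff_weight s (U i \<inter> F)) \<le> (\<Sum>i. hausdorff_weight s (U i))"
      by (intro suminf_le) auto
    moreover have "(\<Sum>i. hausdorff_weight s (U i \<inter> E) + hausdorff_weight s (U i \<inter> F))
        = (\<Sum>i. hausdorff_weight s (U i \<inter> E)) + (\<Sum>i. hausdorff_weight s (U i \<inter> F))"
      by (rule suminf_add[symmetric]) auto
    ultimately show "hausdorff_content s \<delta> E + hausdorff_content s \<delta> F \<le> (\<Sum>i. hausdorff_weight s (U i))"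
      using add_mono[OF hausdorff_content_le[OF sub[of E]] hausdorff_content_le[OF sub[of F]]]
      by (auto intro: order_trans)
  qed
  have "hausdorff_outer s E + hausdorff_outer s F
      = (SUP \<delta>\<in>{0<..}. hausdorff_content s \<delta> E + hausdorff_content s \<delta> F)"
    unfolding hausdorff_outer_def
  proof (rule SUP_add_directed_ennreal[symmetric])
    fix i j :: real assume "i \<in> {0<..}" "j \<in> {0<..}"
    then show "\<exists>k\<in>{0<..}. hausdorff_content s i E + hausdorff_content s j F
        \<le> hausdorff_content s k E + hausdorff_content s k F"
      by (intro bexI[of _ "min i j"] add_mono hausdorff_content_antimono) auto
  qed
  also have "\<dots> \<le> hausdorff_outer s (E \<union> F)"
  proof (rule SUP_least)
    fix \<delta> :: real assume "\<delta> \<in> {0<..}"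
    define \<epsilon> where "\<epsilon> = min \<delta> (\<eta> / 2)"
    have \<epsilon>: "0 < \<epsilon>" "\<epsilon> \<le> \<delta>" "\<epsilon> < \<eta>"
      using \<open>\<delta> \<in> {0<..}\<close> \<open>0 < \<eta>\<close> by (auto simp: \<epsilon>_def)
    have "hausdorff_content s \<delta> E + hausdorff_content s \<delta> F
        \<le> hausdorff_content s \<epsilon> E + hausdorff_content s \<epsilon> F"
      using \<epsilon> by (intro add_mono hausdorff_content_antimono)
    also have "\<dots> \<le> hausdorff_content s \<epsilon> (E \<union> F)"
      using \<epsilon> by (intro main)
    also have "\<dots> \<le> hausdorff_outer s (E \<union> F)"
      unfolding hausdorff_outer_def using \<epsilon> by (intro SUP_upper) auto
    finally show "hausdorff_content s \<delta> E + hausdorff_content s \<delta> F \<le> hausdorff_outer s (E \<union> F)" .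
  qed
  finally show ?thesis .
qed

lemma hausdorff_outer_closed:
  assumes "closed C"
  shows "hausdorff_outer s (X \<inter> C) + hausdorff_outer s (X - C) = hausdorff_outer s X"
proof (cases "C = {} \<or> hausdorff_outer s X = top")
  case True
  then show ?thesis
    using hausdorff_outer_Un[of s "X \<inter> C" "X - C"] by (auto simp: Int_Diff_Un top_unique)
next
  case False
  then have "C \<noteq> {}" and fin: "hausdorff_outer s X \<noteq> top" by auto
  define f where "f = (\<lambda>x. infdist x C)"
  have f_dist: "f x \<le> f y + dist x y" for x y
    unfolding f_def by (rule infdist_triangle)
  define G where "G n = {x \<in> X. 1 / (real n + 1) \<le> f x}" for n :: nat
  define R where "R n = {x \<in> X. 1 / (real n + 2) \<le> f x \<and> f x < 1 / (real n + 1)}" for n :: nat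
  have sepG: "hausdorff_outer s (X \<inter> C) + hausdorff_outer s (G n) \<le> hausdorff_outer s X" for n
  proof -
    have "hausdorff_outer s (X \<inter> C) + hausdorff_outer s (G n) \<le> hausdorff_outer s (X \<inter> C \<union> G n)"
    proof (rule hausdorff_outer_separated)
      show "0 < 1 / (real n + 1)" by simp
      fix x y assume "x \<in> X \<inter> C" "y \<in> G n"
      then show "1 / (real n + 1) \<le> dist x y"
        using f_dist[of y x] by (simp add: G_def f_def dist_commute)
    qed
    also have "\<dots> \<le> hausdorff_outer s X" by (rule hausdorff_outer_mono) (auto simp: G_def)
    finally show ?thesis .
  qed
  have part: "(\<Sum>k<n. hausdorff_outer s (R (2 * k + p))) \<le> hausdorff_outer s (\<Union>k<n. R (2 * k + p))"
    for n p
  proof (induction n)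
    case (Suc n)
    have "(\<Sum>k<Suc n. hausdorff_outer s (R (2 * k + p)))
        \<le> hausdorff_outer s (\<Union>k<n. R (2 * k + p)) + hausdorff_outer s (R (2 * n + p))"
      using Suc by (simp add: add_right_mono)
    also have "\<dots> \<le> hausdorff_outer s ((\<Union>k<n. R (2 * k + p)) \<union> R (2 * n + p))"
    proof (cases "n = 0")
      case False
      show ?thesis
      proof (rule hausdorff_outer_separated)
        let ?a = "real (2 * n + p)"
        have a: "?a > 0" using False by simp
        have "0 < 1 / b - 1 / (b + 1)" if "0 < b" for b :: real
          using that by (simp add: field_simps add_pos_pos)
        then show "0 < 1 / ?a - 1 / (?a + 1)" using a .
        fix x y assume "x \<in> (\<Union>k<n. R (2 * k + p))" and y: "y \<in> R (2 * n + p)"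
        then obtain k where "k < n" and x: "x \<in> R (2 * k + p)" by blast
        then have "real (2 * k + p) + 2 \<le> ?a" by simp
        then have "1 / ?a \<le> 1 / (real (2 * k + p) + 2)" using a by (intro divide_left_mono) auto
        also have "\<dots> \<le> f x" using x by (simp add: R_def)
        finally have "1 / ?a \<le> f x" .
        moreover have "f y < 1 / (?a + 1)" using y by (simp add: R_def)
        ultimately show "1 / ?a - 1 / (?a + 1) \<le> dist x y" using f_dist[of x y] by linarith
      qed
    qed simp
    also have "(\<Union>k<n. R (2 * k + p)) \<union> R (2 * n + p) = (\<Union>k<Suc n. R (2 * k + p))"
      by (auto simp: lessThan_Suc)
    finally show ?case .
  qed simp
  have "(\<Sum>k<n. hausdorff_outer s (R (2 * k + p))) \<le> hausdorff_outer s X" for n p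
    using part[where n=n and p=p]
    by (rule order_trans) (auto intro!: hausdorff_outer_mono simp: R_def)
  note part' = this
  have "(\<Sum>k<n. hausdorff_outer s (R k)) \<le> 2 * hausdorff_outer s X" for n
  proof -
    have *: "(\<Sum>k<2*n. g k) = (\<Sum>k<n. g (2 * k + 0)) + (\<Sum>k<n. g (2 * k + 1))" for g :: "nat \<Rightarrow> ennreal"
      by (induction n) (auto simp: ac_simps)
    have "(\<Sum>k<n. hausdorff_outer s (R k)) \<le> (\<Sum>k<2*n. hausdorff_outer s (R k))"
      by (intro sum_mono2) auto
    also have "\<dots> \<le> hausdorff_outer s X + hausdorff_outer s X"
      unfolding * by (intro add_mono part')
    finally show ?thesis by (simp add: mult_2)
  qed
  then have "(\<Sum>k. hausdorff_outer s (R k)) \<le> 2 * hausdorff_outer s X"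
    by (simp add: suminf_eq_SUP SUP_least)
  also have "\<dots> < top" using fin by (simp add: ennreal_mult_less_top less_top)
  finally have sumfin: "(\<Sum>k. hausdorff_outer s (R k)) < top" .
  have tail: "(\<lambda>n. \<Sum>k. hausdorff_outer s (R (k + n))) \<longlonglongrightarrow> 0"
  proof -
    have fink: "hausdorff_outer s (R k) \<noteq> top" for k
      using hausdorff_outer_mono[of "R k" X s] fin by (auto simp: R_def top_unique)
    define r where "r k = enn2real (hausdorff_outer s (R k))" for k
    have r: "hausdorff_outer s (R k) = ennreal (r k)" "0 \<le> r k" for k
      using fink by (auto simp: r_def less_top)
    have sm: "summable r"
      using sumfin r by (intro summable_suminf_not_top) auto
    have "(\<lambda>n. \<Sum>k. r (k + n)) \<longlonglongrightarrow> 0"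
      using suminf_exist_split2[OF sm] .
    then have "(\<lambda>n. ennreal (\<Sum>k. r (k + n))) \<longlonglongrightarrow> ennreal 0"
      by (rule tendsto_ennrealI)
    moreover have "ennreal (\<Sum>k. r (k + n)) = (\<Sum>k. hausdorff_outer s (R (k + n)))" for n
      using r sm by (simp add: suminf_ennreal2 summable_iff_shift)
    ultimately show ?thesis by simp
  qed
  have cover: "X - C \<subseteq> G n \<union> (\<Union>k. R (k + n))" for n
  proof
    fix x assume x: "x \<in> X - C"
    then have pos: "0 < f x"
      using in_closed_iff_infdist_zero[OF assms \<open>C \<noteq> {}\<close>, of x] infdist_nonneg[of x C]
      by (auto simp: f_def less_le)
    show "x \<in> G n \<union> (\<Union>k. R (k + n))"
    proof (cases "x \<in> G n")
      case False
      then have lt: "f x < 1 / (real n + 1)" using x by (auto simp: G_def)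
      define P where "P m \<longleftrightarrow> 1 / (real m + 2) \<le> f x" for m
      obtain m0 where m0: "1 / (real m0 + 1) < f x"
        using reals_Archimedean[OF pos] by (auto simp: inverse_eq_divide add.commute)
      have "1 / (real m0 + 2) \<le> 1 / (real m0 + 1)" by (simp add: field_simps)
      then have "P m0" using m0 by (simp add: P_def)
      define m where "m = (LEAST m. P m)"
      have "P m" unfolding m_def by (rule LeastI) fact
      have up: "f x < 1 / (real m + 1)"
      proof (cases m)
        case 0
        have "1 / (real n + 1) \<le> 1" by simp
        then have "f x < 1" using lt by (rule less_le_trans[rotated])
        then show ?thesis using 0 by simp
      next
        case (Suc l)
        then have "\<not> P l" using not_less_Least[of l P] by (simp add: m_def)
        then show ?thesis using Suc by (simp add: P_def add.commute)
      qed
      have "n \<le> m"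
      proof (rule ccontr)
        assume "\<not> n \<le> m"
        then have "1 / (real n + 1) \<le> 1 / (real m + 2)" by (intro divide_left_mono) auto
        then show False using \<open>P m\<close> lt by (simp add: P_def)
      qed
      have "x \<in> R m" using x up \<open>P m\<close> by (simp add: R_def P_def)
      then have "x \<in> R ((m - n) + n)" using \<open>n \<le> m\<close> by simp
      then show ?thesis by blast
    qed simp
  qed
  have ineq: "hausdorff_outer s (X \<inter> C) + hausdorff_outer s (X - C)
      \<le> hausdorff_outer s X + (\<Sum>k. hausdorff_outer s (R (k + n)))" for n
  proof -
    have "hausdorff_outer s (X - C) \<le> hausdorff_outer s (G n) + (\<Sum>k. hausdorff_outer s (R (k + n)))"
      by (rule order_trans[OF hausdorff_outer_mono[OF cover]]
          order_trans[OF hausdorff_outer_Un] add_left_mono hausdorff_outer_UN)+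
    then have "hausdorff_outer s (X \<inter> C) + hausdorff_outer s (X - C)
        \<le> hausdorff_outer s (X \<inter> C) + (hausdorff_outer s (G n) + (\<Sum>k. hausdorff_outer s (R (k + n))))"
      by (rule add_left_mono)
    also have "\<dots> \<le> hausdorff_outer s X + (\<Sum>k. hausdorff_outer s (R (k + n)))"
      unfolding add.assoc[symmetric] by (rule add_right_mono[OF sepG])
    finally show ?thesis .
  qed
  have "(\<lambda>n. hausdorff_outer s X + (\<Sum>k. hausdorff_outer s (R (k + n)))) \<longlonglongrightarrow> hausdorff_outer s X + 0"
    by (intro tendsto_add tendsto_const tail)
  then have "hausdorff_outer s (X \<inter> C) + hausdorff_outer s (X - C) \<le> hausdorff_outer s X + 0"
    by (rule LIMSEQ_le_const) (use ineq in blast)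
  moreover have "hausdorff_outer s X \<le> hausdorff_outer s (X \<inter> C) + hausdorff_outer s (X - C)"
    using hausdorff_outer_Un[of s "X \<inter> C" "X - C"] by (simp add: Int_Diff_Un)
  ultimately show ?thesis by (intro antisym) simp_all
qed

lemma hausdorff_outer_measure_space: "measure_space UNIV (sets borel) (hausdorff_outer s)"
proof -
  interpret P: sigma_algebra UNIV "UNIV :: 'a set set" by (rule sigma_algebra_Pow[of UNIV, simplified])
  let ?L = "lambda_system UNIV UNIV (hausdorff_outer s) :: 'a set set"
  have oms: "outer_measure_space UNIV (hausdorff_outer s :: 'a set \<Rightarrow> ennreal)"
    by (auto simp: outer_measure_space_def positive_def increasing_def countably_subadditive_def
        intro: hausdorff_outer_mono hausdorff_outer_UN)
  have L: "measure_space UNIV ?L (hausdorff_outer s)"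
    by (rule P.caratheodory_lemma[OF oms])
  then interpret L: sigma_algebra UNIV ?L by (simp add: measure_space_def)
  have "sigma_sets UNIV (Collect closed) \<subseteq> ?L"
    by (rule L.sigma_sets_subset) (auto simp: P.lambda_system_eq hausdorff_outer_closed)
  then have "sets borel \<subseteq> ?L"
    by (simp add: borel_eq_closed)
  then show ?thesis
    using L sets.sigma_algebra_axioms[of "borel :: 'a measure"]
    by (auto simp: measure_space_def positive_def countably_additive_def)
qed

lemma space_hausdorff_measure [simp]: "space (hausdorff_measure s) = UNIV"
  by (simp add: hausdorff_measure_def)

lemma sets_hausdorff_measure [simp, measurable_cong]: "sets (hausdorff_measure s) = sets borel"
  using sets.sigma_sets_eq[of borel] by (simp add: hausdorff_measure_def)

lemma emeasure_hausdorff_measure: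
  "B \<in> sets borel \<Longrightarrow> emeasure (hausdorff_measure s) B = hausdorff_outer s B"
  using hausdorff_outer_measure_space[where 'a='a, of s]
  unfolding hausdorff_measure_def
  by (intro emeasure_measure_of_sigma) (auto simp: measure_space_def)

section \<open>Parallel sets and parallel surface measures\<close>

definition parallel_set :: "'a::metric_space set \<Rightarrow> real \<Rightarrow> 'a set" where
  "parallel_set A r = {x. infdist x A < r}"

definition parallel_volume :: "'a::euclidean_space set \<Rightarrow> real \<Rightarrow> real" where
  "parallel_volume A r = measure lborel (parallel_set A r)"

definition parallel_surface_measure :: "'a::euclidean_space set \<Rightarrow> real \<Rightarrow> 'a measure" where
  "parallel_surface_measure A r =
     measure_of UNIV (sets borel)
       (\<lambda>B. emeasure (hausdorff_measure (DIM('a) - 1)) (frontier (parallel_set A r) \<inter> B))"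

lemma sets_parallel_surface_measure [simp, measurable_cong]:
  "sets (parallel_surface_measure A r) = sets borel"
  using sets.sigma_sets_eq[of borel] by (simp add: parallel_surface_measure_def)

lemma emeasure_parallel_surface_measure:
  fixes A :: "'a::euclidean_space set"
  assumes "B \<in> sets borel"
  shows "emeasure (parallel_surface_measure A r) B
    = emeasure (hausdorff_measure (DIM('a) - 1)) (frontier (parallel_set A r) \<inter> B)"
  unfolding parallel_surface_measure_def
proof (rule emeasure_measure_of_sigma)
  let ?F = "frontier (parallel_set A r)" and ?H = "hausdorff_measure (DIM('a) - 1) :: 'a measure"
  show "sigma_algebra UNIV (sets borel)" using sets.sigma_algebra_axioms[of borel] by simp
  show "countably_additive (sets borel) (\<lambda>B. emeasure ?H (?F \<inter> B))"
  proof (rule countably_additiveI)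
    fix D :: "nat \<Rightarrow> 'a set"
    assume D: "range D \<subseteq> sets borel" "disjoint_family D"
    have "(\<Sum>i. emeasure ?H (?F \<inter> D i)) = emeasure ?H (\<Union>i. ?F \<inter> D i)"
    proof (rule suminf_emeasure)
      have "D i \<in> sets borel" for i using D by blast
      then have "?F \<inter> D i \<in> sets borel" for i
        by (rule sets.Int[OF borel_closed[OF frontier_closed]])
      then show "range (\<lambda>i. ?F \<inter> D i) \<subseteq> sets ?H" by (simp add: image_subset_iff)
      show "disjoint_family (\<lambda>i. ?F \<inter> D i)"
        using D(2) unfolding disjoint_family_on_def by blast
    qed
    then show "(\<Sum>i. emeasure ?H (?F \<inter> D i)) = emeasure ?H (?F \<inter> (\<Union>i. D i))"
      by (simp only: Int_UN_distrib)
  qed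
next
  show "positive (sets borel)
      (\<lambda>B. emeasure (hausdorff_measure (DIM('a) - 1)) (frontier (parallel_set A r) \<inter> B))"
    by (simp add: positive_def)
qed fact

section \<open>Weak convergence\<close>

definition finite_borel :: "'a::topological_space measure \<Rightarrow> bool" where
  "finite_borel M \<longleftrightarrow> sets M = sets borel \<and> finite_measure M"

text \<open>
  Finiteness is part of the notion: Bochner integrals of non-integrable functions are 0 by
  convention, so convergence of integrals would be meaningless without it.
\<close>

definition weakly_converges ::
    "('i \<Rightarrow> 'a::topological_space measure) \<Rightarrow> 'a measure \<Rightarrow> 'i filter \<Rightarrow> bool" where
  "weakly_converges M N F \<longleftrightarrow>
     (\<forall>\<^sub>F i in F. finite_borel (M i)) \<and> finite_borel N \<and>
     (\<forall>f :: 'a \<Rightarrow> real. continuous_on UNIV f \<and> bounded (range f) \<longrightarrow>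
        ((\<lambda>i. \<integral>x. f x \<partial>M i) \<longlongrightarrow> (\<integral>x. f x \<partial>N)) F)"

end

theory Submission
  imports Defs
begin

text \<open>
  Write \<open>d\<close> for the dimension, \<open>dist(x, A)\<close> for the distance to \<open>A\<close>, \<open>V\<close> for the volume
  function and \<open>L(s)\<close> for the level set \<open>{x. dist(x, A) = s}\<close>, which for \<open>s > 0\<close> is the
  boundary of the \<open>s\<close>-parallel set. For \<open>s < t\<close> let \<open>R(t, s)\<close> be the set of those points of
  \<open>L(s)\<close> that lie on a segment from a point of \<open>L(t)\<close> to one of its nearest points in \<open>A\<close>.

  The metric projection onto \<open>A\<close> is a monotone relation (\<open>nearest_monotone\<close>). An elementary
  inequality for two vectors with nonnegative inner product (\<open>norm_segment_ratio\<close>) therefore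
  shows that moving along these segments from \<open>R(t, s)\<close> to \<open>R(t, s')\<close> is a Lipschitz
  surjection, with constant \<open>s' / s\<close> if \<open>s \<le> s'\<close> and \<open>(t - s') / (t - s)\<close> if \<open>s' \<le> s\<close>,
  and that it displaces points by \<open>\<bar>s' - s\<bar>\<close>. Both constants tend to 1 as \<open>s' \<rightarrow> s\<close> with \<open>t\<close>
  fixed. Hence the Hausdorff measure restricted to \<open>R(t, s)\<close> depends weakly continuously on
  \<open>s\<close>. It remains to show that \<open>L(s) - R(t, s)\<close> has small measure, uniformly in \<open>s\<close> near
  \<open>r0\<close>, once \<open>t > r0\<close> is close to \<open>r0\<close>.

  This is where differentiability enters. The same Lipschitz estimate gives Kneser's inequality
  \<open>V(l b) - V(l a) \<le> l ^ d (V(b) - V(a))\<close> for \<open>l \<ge> 1\<close>, and more precisely a lower bound for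
  the volume of the part of a shell through which segments from level \<open>t\<close> pass. Kneser's
  inequality implies that \<open>V\<close> is a concave function of \<open>r ^ d\<close> (\<open>kneser_slope\<close>); as a concave
  function differentiable at a point is strictly differentiable there, all the quotients
  \<open>(V(y) - V(x)) / (y ^ d - x ^ d)\<close> with \<open>x < y\<close> near \<open>r0\<close> lie in an interval
  \<open>[g - \<eta>, g + \<eta>]\<close>. A thin shell \<open>{s - \<rho> \<le> dist(x, A) \<le> s + \<rho>}\<close> thus has volume at most
  \<open>(g + \<eta>) ((s + \<rho>) ^ d - (s - \<rho>) ^ d)\<close>, while its part reached by segments from level \<open>t\<close>
  has volume at least \<open>(g - \<eta>) ((s + \<rho>) ^ d - (s - \<rho>) ^ d)\<close>. A compact set
  \<open>K \<subseteq> L(s) - R(t, s)\<close> has a neighbourhood of radius \<open>\<rho>\<close> in the remaining part, whose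
  volume is \<open>O(\<eta> \<rho>)\<close>, and a covering argument (\<open>hausdorff_outer_le_minkowski\<close>) bounds the
  Hausdorff measure of \<open>K\<close> by \<open>O(\<eta>)\<close>. Since only smallness matters here, no sharp constant is
  needed in the comparison of Hausdorff measure and volume.
\<close>

section \<open>Lipschitz images\<close>

lemma hausdorff_weight_lipschitz_image:
  assumes "L-lipschitz_on E f" "bounded U"
  shows "bounded (f ` (U \<inter> E))"
    and "diameter (f ` (U \<inter> E)) \<le> L * diameter U"
    and "hausdorff_weight k (f ` (U \<inter> E)) \<le> ennreal (L ^ k) * hausdorff_weight k U"
proof -
  have L: "0 \<le> L" using assms(1) by (rule lipschitz_on_nonneg)
  have d0: "0 \<le> diameter U" using assms(2) by (rule diameter_ge_0)
  have dist: "dist (f x) (f y) \<le> L * diameter U" if "x \<in> U \<inter> E" "y \<in> U \<inter> E" for x y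
  proof -
    have "dist (f x) (f y) \<le> L * dist x y"
      using lipschitz_onD[OF assms(1)] that by simp
    also have "\<dots> \<le> L * diameter U"
      using that L by (intro mult_left_mono diameter_bounded_bound[OF assms(2)]) auto
    finally show ?thesis .
  qed
  show b: "bounded (f ` (U \<inter> E))"
    unfolding bounded_two_points using dist by blast
  show d: "diameter (f ` (U \<inter> E)) \<le> L * diameter U"
  proof (cases "f ` (U \<inter> E) = {}")
    case True
    then show ?thesis using L d0 by simp
  next
    case False
    show ?thesis unfolding diameter_def[of "f ` (U \<inter> E)"] if_not_P[OF False]
      by (rule cSUP_least) (use False dist in auto)
  qed
  show "hausdorff_weight k (f ` (U \<inter> E)) \<le> ennreal (L ^ k) * hausdorff_weight k U"
  proof (cases "U \<inter> E = {}")
    case True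
    then show ?thesis by (simp add: hausdorff_weight_def)
  next
    case False
    then have ne: "U \<noteq> {}" "f ` (U \<inter> E) \<noteq> {}" by auto
    have "(diameter (f ` (U \<inter> E)) / 2) ^ k \<le> (L * (diameter U / 2)) ^ k"
      using d diameter_ge_0[OF b] by (intro power_mono) auto
    then have "unit_ball_vol (real k) * (diameter (f ` (U \<inter> E)) / 2) ^ k
        \<le> unit_ball_vol (real k) * (L * (diameter U / 2)) ^ k"
      by (rule mult_left_mono) simp
    also have "\<dots> = L ^ k * (unit_ball_vol (real k) * (diameter U / 2) ^ k)"
      by (simp only: power_mult_distrib mult.left_commute)
    finally have le: "unit_ball_vol (real k) * (diameter (f ` (U \<inter> E)) / 2) ^ k
        \<le> L ^ k * (unit_ball_vol (real k) * (diameter U / 2) ^ k)" .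
    have "hausdorff_weight k (f ` (U \<inter> E))
        \<le> ennreal (L ^ k * (unit_ball_vol (real k) * (diameter U / 2) ^ k))"
      unfolding hausdorff_weight_def if_not_P[OF ne(2)] by (rule ennreal_leI[OF le])
    also have "\<dots> = ennreal (L ^ k) * hausdorff_weight k U"
      unfolding hausdorff_weight_def if_not_P[OF ne(1)] using L d0 by (intro ennreal_mult) auto
    finally show ?thesis .
  qed
qed

lemma hausdorff_content_lipschitz_image:
  assumes "L-lipschitz_on E f"
  shows "hausdorff_content k (L * \<delta>) (f ` E) \<le> ennreal (L ^ k) * hausdorff_content k \<delta> E"
proof (cases "L ^ k = 0")
  case True
  \<comment> \<open>here \<open>f\<close> is constant on \<open>E\<close>, and both sides are 0\<close>
  then have "L = 0" "k > 0" by auto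
  have "hausdorff_content k (L * \<delta>) (f ` E) = 0"
  proof (cases "E = {}")
    case True
    then have "(\<lambda>_. {}) \<in> hausdorff_covers (L * \<delta>) (f ` E)"
      using \<open>L = 0\<close> by (simp add: hausdorff_covers_def)
    from hausdorff_content_le[OF this, of k] show ?thesis
      by (simp add: hausdorff_weight_def)
  next
    case False
    then obtain e where "e \<in> E" by blast
    have "f x = f e" if "x \<in> E" for x
      using lipschitz_onD[OF assms that \<open>e \<in> E\<close>] \<open>L = 0\<close> by simp
    then have "f ` E \<subseteq> {f e}" by blast
    then have "(\<lambda>_. {f e}) \<in> hausdorff_covers (L * \<delta>) (f ` E)"
      using \<open>L = 0\<close> by (simp add: hausdorff_covers_def)
    from hausdorff_content_le[OF this, of k] show ?thesis
      using \<open>k > 0\<close> by (simp add: hausdorff_weight_def power_0_left)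
  qed
  then show ?thesis by simp
next
  case False
  have L: "0 \<le> L" using assms by (rule lipschitz_on_nonneg)
  have "hausdorff_content k (L * \<delta>) (f ` E) \<le> ennreal (L ^ k) * (\<Sum>i. hausdorff_weight k (U i))"
    if U: "U \<in> hausdorff_covers \<delta> E" for U
  proof -
    have b: "bounded (U i)" "diameter (U i) \<le> \<delta>" for i
      using U by (auto simp: hausdorff_covers_def)
    have "diameter (f ` (U i \<inter> E)) \<le> L * \<delta>" for i
      using hausdorff_weight_lipschitz_image(2)[OF assms b(1)] mult_left_mono[OF b(2) L]
      by (rule order_trans)
    moreover have "f ` E \<subseteq> (\<Union>i. f ` (U i \<inter> E))"
      using U unfolding hausdorff_covers_def by blast
    ultimately have "(\<lambda>i. f ` (U i \<inter> E)) \<in> hausdorff_covers (L * \<delta>) (f ` E)"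
      using hausdorff_weight_lipschitz_image(1)[OF assms b(1)] by (simp add: hausdorff_covers_def)
    then have "hausdorff_content k (L * \<delta>) (f ` E) \<le> (\<Sum>i. hausdorff_weight k (f ` (U i \<inter> E)))"
      by (rule hausdorff_content_le)
    also have "\<dots> \<le> (\<Sum>i. ennreal (L ^ k) * hausdorff_weight k (U i))"
      by (intro suminf_le hausdorff_weight_lipschitz_image(3)[OF assms b(1)]) auto
    finally show ?thesis by simp
  qed
  then have "hausdorff_content k (L * \<delta>) (f ` E) / ennreal (L ^ k) \<le> hausdorff_content k \<delta> E"
    using False L unfolding hausdorff_content_def[of _ \<delta>]
    by (intro INF_greatest divide_le_posI_ennreal) (auto simp: mult.commute)
  from mult_left_mono[OF this, of "ennreal (L ^ k)"]
  have "hausdorff_content k (L * \<delta>) (f ` E) * ennreal (L ^ k) / ennreal (L ^ k)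
      \<le> ennreal (L ^ k) * hausdorff_content k \<delta> E"
    by (simp add: ennreal_times_divide mult.commute)
  moreover have "ennreal (L ^ k) \<noteq> 0"
    using False L zero_le_power[OF L, of k] unfolding ennreal_eq_0_iff by linarith
  ultimately show ?thesis
    by (subst (asm) ennreal_mult_divide_eq) simp_all
qed

lemma hausdorff_outer_lipschitz_image:
  assumes "L-lipschitz_on E f"
  shows "hausdorff_outer k (f ` E) \<le> ennreal (L ^ k) * hausdorff_outer k E"
  unfolding hausdorff_outer_def[of _ "f ` E"]
proof (rule SUP_least)
  fix \<delta> :: real assume \<delta>: "\<delta> \<in> {0<..}"
  have L: "0 \<le> L" using assms by (rule lipschitz_on_nonneg)
  have "L * (\<delta> / (L + 1)) \<le> \<delta>"
    using L \<delta> by (simp add: field_simps)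
  then have "hausdorff_content k \<delta> (f ` E) \<le> hausdorff_content k (L * (\<delta> / (L + 1))) (f ` E)"
    by (rule hausdorff_content_antimono)
  also have "\<dots> \<le> ennreal (L ^ k) * hausdorff_content k (\<delta> / (L + 1)) E"
    by (rule hausdorff_content_lipschitz_image[OF assms])
  also have "\<dots> \<le> ennreal (L ^ k) * hausdorff_outer k E"
    unfolding hausdorff_outer_def using L \<delta>
    by (intro mult_left_mono SUP_upper) auto
  finally show "hausdorff_content k \<delta> (f ` E) \<le> ennreal (L ^ k) * hausdorff_outer k E" .
qed

lemma emeasure_UN_countable_le:
  assumes C: "countable C" and X: "\<And>i. i \<in> C \<Longrightarrow> X i \<in> sets M"
  shows "emeasure M (\<Union>i\<in>C. X i) \<le> (\<integral>\<^sup>+i. emeasure M (X i) \<partial>count_space C)"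
proof -
  have U: "(\<Union>i\<in>C. X i) \<in> sets M" using C X by (intro sets.countable_UN') auto
  have pt: "indicator (\<Union>i\<in>C. X i) x \<le> (\<integral>\<^sup>+i. indicator (X i) x \<partial>count_space C)" for x
  proof (cases "x \<in> (\<Union>i\<in>C. X i)")
    case True
    then obtain i where i: "i \<in> C" "x \<in> X i" by blast
    have "(indicator (\<Union>i\<in>C. X i) x :: ennreal) = emeasure (count_space C) {i}"
      using True i by simp
    also have "\<dots> = (\<integral>\<^sup>+j. indicator {i} j \<partial>count_space C)"
      using i by (subst nn_integral_indicator) auto
    also have "\<dots> \<le> (\<integral>\<^sup>+i. indicator (X i) x \<partial>count_space C)"
      using i by (intro nn_integral_mono) (auto simp: indicator_def)
    finally show ?thesis .
  qed simp
  have "emeasure M (\<Union>i\<in>C. X i) = (\<integral>\<^sup>+x. indicator (\<Union>i\<in>C. X i) x \<partial>M)"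
    using U by simp
  also have "\<dots> \<le> (\<integral>\<^sup>+x. \<integral>\<^sup>+i. indicator (X i) x \<partial>count_space C \<partial>M)"
    by (intro nn_integral_mono pt)
  also have "\<dots> = (\<integral>\<^sup>+i. \<integral>\<^sup>+x. indicator (X i) x \<partial>M \<partial>count_space C)"
    using C X by (intro nn_integral_count_space_nn_integral) auto
  also have "\<dots> = (\<integral>\<^sup>+i. emeasure M (X i) \<partial>count_space C)"
    using X by (intro nn_integral_cong) simp
  finally show ?thesis .
qed

text \<open>
  By Vitali's theorem, disjoint balls centred in \<open>E\<close> and contained in an open set slightly larger
  than \<open>E\<close> cover \<open>E\<close> up to a null set, and the image of the part of \<open>E\<close> in a ball of radius
  \<open>r\<close> lies in a ball of radius \<open>L r\<close>.
\<close>

lemma emeasure_lborel_lipschitz_image: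
  fixes f :: "'a::euclidean_space \<Rightarrow> 'a"
  assumes lip: "L-lipschitz_on E f" and E: "compact E"
  shows "emeasure lborel (f ` E) \<le> ennreal (L ^ DIM('a)) * emeasure lborel E"
proof -
  have L: "0 \<le> L" using lip by (rule lipschitz_on_nonneg)
  have E': "E \<in> sets borel" using E by (simp add: borel_closed compact_imp_closed)
  have bound: "emeasure lborel (f ` E) \<le> ennreal (L ^ DIM('a)) * emeasure lborel U"
    if U: "open U" "E \<subseteq> U" for U
  proof -
    define K where "K = {(x, r). x \<in> E \<and> 0 < r \<and> cball x r \<subseteq> U}"
    have pos: "0 < snd i" if "i \<in> K" for i
      using that by (auto simp: K_def)
    have fine: "\<exists>i. i \<in> K \<and> x \<in> cball (fst i) (snd i) \<and> snd i < d" if "x \<in> E" "0 < d" for x d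
    proof -
      have "x \<in> U" using U(2) that(1) by (rule subsetD)
      then obtain e where e: "0 < e" "cball x e \<subseteq> U"
        using U(1)[unfolded open_contains_cball] by blast
      have "cball x (min e (d / 2)) \<subseteq> cball x e" by auto
      with e have "(x, min e (d / 2)) \<in> K"
        using that(1,2) unfolding K_def by auto
      then show ?thesis
        using that(1,2) e(1) by (intro exI[of _ "(x, min e (d / 2))"]) simp
    qed
    obtain C where C: "countable C" "C \<subseteq> K"
      and disj: "pairwise (\<lambda>i j. disjnt (cball (fst i) (snd i)) (cball (fst j) (snd j))) C"
      and neg: "negligible (E - (\<Union>i\<in>C. cball (fst i) (snd i)))"
      by (rule Vitali_covering_theorem_cballs[OF pos fine])
    let ?N = "E - (\<Union>i\<in>C. cball (fst i) (snd i))"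
    have CK: "fst i \<in> E" "0 < snd i" "cball (fst i) (snd i) \<subseteq> U" if "i \<in> C" for i
      using subsetD[OF C(2) that] by (simp_all add: K_def case_prod_unfold)
    have "negligible (f ` ?N)"
    proof (rule negligible_locally_Lipschitz_image[OF order_refl neg])
      fix x assume "x \<in> ?N"
      then show "\<exists>T B. open T \<and> x \<in> T \<and> (\<forall>y\<in>?N \<inter> T. norm (f y - f x) \<le> B * norm (y - x))"
        using lipschitz_onD[OF lip] unfolding dist_norm
        by (intro exI[of _ UNIV] exI[of _ L] conjI ballI open_UNIV UNIV_I) blast
    qed
    then have null: "emeasure lebesgue (f ` ?N) = 0" and Nm: "f ` ?N \<in> sets lebesgue"
      by (auto simp: negligible_iff_null_sets null_sets_def)
    have fE: "f ` E \<in> sets borel"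
      using E lip by (intro borel_closed compact_imp_closed compact_continuous_image
          lipschitz_on_continuous_on)
    let ?B = "\<Union>i\<in>C. cball (f (fst i)) (L * snd i)"
    have sub: "f ` E \<subseteq> ?B \<union> f ` ?N"
    proof
      fix y assume "y \<in> f ` E"
      then obtain x where x: "x \<in> E" "y = f x" by blast
      show "y \<in> ?B \<union> f ` ?N"
      proof (cases "x \<in> ?N")
        case False
        then obtain i where i: "i \<in> C" "x \<in> cball (fst i) (snd i)" using x by blast
        have "dist (f (fst i)) (f x) \<le> L * dist (fst i) x"
          using lipschitz_onD[OF lip] CK(1)[OF i(1)] x by blast
        also have "\<dots> \<le> L * snd i" using i L by (intro mult_left_mono) auto
        finally show ?thesis using i x by (intro UnI1) auto
      qed (use x in blast)
    qed
    have Bm: "?B \<in> sets borel" using C(1) by (intro sets.countable_UN') auto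
    have "emeasure lborel (f ` E) = emeasure lebesgue (f ` E)"
      using fE by simp
    also have "\<dots> \<le> emeasure lebesgue (?B \<union> f ` ?N)"
      using Bm Nm by (intro emeasure_mono sub sets.Un) auto
    also have "\<dots> \<le> emeasure lebesgue ?B + emeasure lebesgue (f ` ?N)"
      using Bm Nm by (intro emeasure_subadditive) auto
    also have "\<dots> = emeasure lborel ?B"
      using Bm null by simp
    also have "\<dots> \<le> (\<integral>\<^sup>+i. emeasure lborel (cball (f (fst i)) (L * snd i)) \<partial>count_space C)"
      using C(1) by (intro emeasure_UN_countable_le) auto
    also have "\<dots> = (\<integral>\<^sup>+i. ennreal (L ^ DIM('a)) * emeasure lborel (cball (fst i) (snd i)) \<partial>count_space C)"
      using CK(2) L
      by (intro nn_integral_cong)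
        (simp add: emeasure_cball less_imp_le ennreal_mult[symmetric] power_mult_distrib mult_ac)
    also have "\<dots> = ennreal (L ^ DIM('a)) * (\<integral>\<^sup>+i. emeasure lborel (cball (fst i) (snd i)) \<partial>count_space C)"
      by (rule nn_integral_cmult) simp
    also have "(\<integral>\<^sup>+i. emeasure lborel (cball (fst i) (snd i)) \<partial>count_space C)
        = emeasure lborel (\<Union>i\<in>C. cball (fst i) (snd i))"
      using C(1) disj
      by (intro emeasure_UN_countable[symmetric])
        (auto simp: disjoint_family_on_def pairwise_def disjnt_def)
    also have "\<dots> \<le> emeasure lborel U"
      using CK(3) U(1) by (intro emeasure_mono) auto
    finally show ?thesis by (simp add: mult_left_mono)
  qed
  have fin: "emeasure lborel E < top"
    using emeasure_bounded_finite[OF compact_imp_bounded[OF E]] by (simp add: less_top)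
  show ?thesis
  proof (rule ennreal_le_epsilon)
    fix e :: real assume e: "0 < e"
    define e' where "e' = e / (L ^ DIM('a) + 1)"
    have Lp: "0 \<le> L ^ DIM('a)" using L by simp
    have e': "0 < e'" using e Lp unfolding e'_def by (intro divide_pos_pos) auto
    have le: "L ^ DIM('a) * e' \<le> e" using e Lp by (simp add: e'_def field_simps)
    obtain U where U: "open U" "E \<subseteq> U" "emeasure lborel (U - E) < ennreal e'"
      using outer_regular_lborel[OF E' e'] .
    have "emeasure lborel U = emeasure lborel E + emeasure lborel (U - E)"
      using U E' by (subst plus_emeasure) (auto simp: Un_absorb1)
    also have "\<dots> \<le> emeasure lborel E + ennreal e'"
      using U(3) by (intro add_left_mono) auto
    finally have "ennreal (L ^ DIM('a)) * emeasure lborel U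
        \<le> ennreal (L ^ DIM('a)) * (emeasure lborel E + ennreal e')"
      by (rule mult_left_mono) simp
    also have "\<dots> = ennreal (L ^ DIM('a)) * emeasure lborel E + ennreal (L ^ DIM('a) * e')"
      using Lp e' by (simp add: distrib_left ennreal_mult)
    also have "\<dots> \<le> ennreal (L ^ DIM('a)) * emeasure lborel E + ennreal e"
      using le by (intro add_left_mono ennreal_leI)
    finally show "emeasure lborel (f ` E) \<le> ennreal (L ^ DIM('a)) * emeasure lborel E + ennreal e"
      using bound[OF U(1,2)] by (rule order_trans[rotated])
  qed
qed

section \<open>Hausdorff measure and the volume of neighbourhoods\<close>

lemma hausdorff_content_finite_cballs:
  fixes a :: "'b \<Rightarrow> 'a::euclidean_space"
  assumes C: "finite C" and sub: "E \<subseteq> (\<Union>i\<in>C. cball (a i) \<rho>)" and "0 \<le> \<rho>"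
  shows "hausdorff_content k (2 * \<rho>) E \<le> ennreal (card C * (unit_ball_vol (real k) * \<rho> ^ k))"
proof -
  obtain g where g: "bij_betw g {..<card C} C"
    using ex_bij_betw_nat_finite[OF C] by (auto simp: atLeast0LessThan)
  define U where "U i = (if i < card C then cball (a (g i)) \<rho> else {})" for i
  have "E \<subseteq> (\<Union>i. U i)"
  proof
    fix x assume "x \<in> E"
    then obtain c where c: "c \<in> C" "x \<in> cball (a c) \<rho>" using sub by blast
    then obtain i where "i < card C" "g i = c" using g unfolding bij_betw_def by (metis imageE lessThan_iff)
    then have "x \<in> U i" using c by (simp add: U_def)
    then show "x \<in> (\<Union>i. U i)" by blast
  qed
  then have "U \<in> hausdorff_covers (2 * \<rho>) E"
    using \<open>0 \<le> \<rho>\<close> by (auto simp: hausdorff_covers_def U_def)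
  then have "hausdorff_content k (2 * \<rho>) E \<le> (\<Sum>i. hausdorff_weight k (U i))"
    by (rule hausdorff_content_le)
  also have "\<dots> = (\<Sum>i<card C. hausdorff_weight k (U i))"
    by (rule suminf_finite) (auto simp: U_def hausdorff_weight_def)
  also have "\<dots> = (\<Sum>i<card C. ennreal (unit_ball_vol (real k) * \<rho> ^ k))"
    using \<open>0 \<le> \<rho>\<close> by (intro sum.cong) (auto simp: U_def hausdorff_weight_def)
  also have "\<dots> = ennreal (card C * (unit_ball_vol (real k) * \<rho> ^ k))"
    using \<open>0 \<le> \<rho>\<close> by (simp add: ennreal_mult ennreal_of_nat_eq_real_of_nat)
  finally show ?thesis .
qed

lemma compact_UN_cball:
  fixes K :: "'a::euclidean_space set"
  assumes "compact K"
  shows "compact (\<Union>x\<in>K. cball x \<rho>)"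
proof -
  have "(\<Union>x\<in>K. cball x \<rho>) = {x + y | x y. x \<in> K \<and> y \<in> cball 0 \<rho>}"
    by (auto simp: dist_norm norm_minus_commute) (metis add_diff_cancel_left' diff_add_cancel add.commute)
  then show ?thesis using compact_sums[OF assms compact_cball[of 0 \<rho>]] by simp
qed

text \<open>
  A set whose \<open>\<rho>\<close>-neighbourhoods have volume at most \<open>c \<rho>\<close> for small \<open>\<rho>\<close> has codimension-one
  Hausdorff measure \<open>O(c)\<close>: among finitely many balls of radius \<open>\<rho>\<close> that cover it one can choose
  disjoint ones whose fivefold enlargements still cover it, and volume bounds their number.
\<close>

lemma hausdorff_outer_le_minkowski:
  fixes K :: "'a::euclidean_space set"
  assumes K: "compact K" and "0 \<le> c"
    and vol: "\<forall>\<^sub>F \<rho> in at_right 0. emeasure lborel (\<Union>x\<in>K. cball x \<rho>) \<le> ennreal (c * \<rho>)"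
  shows "hausdorff_outer (DIM('a) - 1) K
    \<le> ennreal (5 ^ (DIM('a) - 1) * unit_ball_vol (real (DIM('a) - 1)) / unit_ball_vol (real DIM('a)) * c)"
  unfolding hausdorff_outer_def
proof (rule SUP_least)
  let ?k = "DIM('a) - 1" and ?\<omega> = "unit_ball_vol (real DIM('a))"
  fix \<delta> :: real assume "\<delta> \<in> {0<..}"
  obtain b where b: "0 < b" "\<And>\<rho>. 0 < \<rho> \<Longrightarrow> \<rho> < b \<Longrightarrow> emeasure lborel (\<Union>x\<in>K. cball x \<rho>) \<le> ennreal (c * \<rho>)"
    using vol unfolding eventually_at_right_field by auto
  define \<rho> where "\<rho> = min (\<delta> / 10) (b / 2)"
  have \<rho>: "0 < \<rho>" "\<rho> < b" "2 * (5 * \<rho>) \<le> \<delta>" using b(1) \<open>\<delta> \<in> {0<..}\<close> by (auto simp: \<rho>_def min_def)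
  have "K \<subseteq> (\<Union>x\<in>K. ball x \<rho>)" using \<rho>(1) by auto
  then obtain T where T: "T \<subseteq> K" "finite T" "K \<subseteq> (\<Union>x\<in>T. ball x \<rho>)"
    using compactE_image[OF K, of K "\<lambda>x. ball x \<rho>"] by (metis open_ball)
  obtain C :: "'a set" where C: "C \<subseteq> T" "pairwise (\<lambda>i j. disjnt (cball i \<rho>) (cball j \<rho>)) C"
      "K \<subseteq> (\<Union>i\<in>C. cball i (5 * \<rho>))"
  proof (rule Vitali_covering_lemma_cballs[of K "\<lambda>x. x" "\<lambda>_. \<rho>" T \<rho>])
    show "K \<subseteq> (\<Union>i\<in>T. cball i \<rho>)" using T(3) by force
  qed (use \<rho> in auto)
  have fC: "finite C" using C(1) T(2) by (rule finite_subset)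
  have "ennreal (card C * (?\<omega> * \<rho> ^ DIM('a))) = (\<Sum>x\<in>C. emeasure lborel (cball x \<rho>))"
    using \<rho>(1) by (simp add: emeasure_cball ennreal_mult ennreal_of_nat_eq_real_of_nat)
  also have "\<dots> = emeasure lborel (\<Union>x\<in>C. cball x \<rho>)"
    using C(2) fC by (intro sum_emeasure)
      (auto simp: disjoint_family_on_def pairwise_def disjnt_def)
  also have "\<dots> \<le> emeasure lborel (\<Union>x\<in>K. cball x \<rho>)"
  proof (rule emeasure_mono)
    have "compact (\<Union>x\<in>K. cball x \<rho>)" using K by (rule compact_UN_cball)
    then show "(\<Union>x\<in>K. cball x \<rho>) \<in> sets lborel" by (simp add: borel_closed compact_imp_closed)
  qed (use C(1) T(1) in auto)
  also have "\<dots> \<le> ennreal (c * \<rho>)" using b(2) \<rho> by blast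
  finally have "card C * (?\<omega> * \<rho> ^ DIM('a)) \<le> c * \<rho>"
    using \<rho>(1) \<open>0 \<le> c\<close> by (simp add: ennreal_le_iff)
  moreover have "\<rho> ^ DIM('a) = \<rho> ^ ?k * \<rho>"
    using DIM_positive[where 'a='a] by (metis Suc_diff_1 power_Suc mult.commute)
  ultimately have "card C * (?\<omega> * \<rho> ^ ?k) * \<rho> \<le> c * \<rho>" by (simp add: mult_ac)
  then have "card C * (?\<omega> * \<rho> ^ ?k) \<le> c" using \<rho>(1) by simp
  then have le: "card C * \<rho> ^ ?k \<le> c / ?\<omega>"
    by (simp add: field_simps)
  have "hausdorff_content ?k \<delta> K \<le> hausdorff_content ?k (2 * (5 * \<rho>)) K"
    by (rule hausdorff_content_antimono[OF \<rho>(3)])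
  also have "\<dots> \<le> ennreal (card C * (unit_ball_vol (real ?k) * (5 * \<rho>) ^ ?k))"
    using \<rho>(1) by (intro hausdorff_content_finite_cballs[OF fC C(3)]) simp
  also have "\<dots> \<le> ennreal (5 ^ ?k * unit_ball_vol (real ?k) / ?\<omega> * c)"
  proof (rule ennreal_leI)
    have "5 ^ ?k * unit_ball_vol (real ?k) * (card C * \<rho> ^ ?k)
        \<le> 5 ^ ?k * unit_ball_vol (real ?k) * (c / ?\<omega>)"
      by (rule mult_left_mono[OF le]) simp
    then show "card C * (unit_ball_vol (real ?k) * (5 * \<rho>) ^ ?k) \<le> 5 ^ ?k * unit_ball_vol (real ?k) / ?\<omega> * c"
      by (simp add: power_mult_distrib mult_ac)
  qed
  finally show "hausdorff_content ?k \<delta> K \<le> ennreal (5 ^ ?k * unit_ball_vol (real ?k) / ?\<omega> * c)" .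
qed

section \<open>Metric projections\<close>

text \<open>
  The graph of the (multivalued) metric projection onto \<open>A\<close>: pairs of a point and a point of
  \<open>A\<close> nearest to it.
\<close>

definition nearest :: "'a::metric_space set \<Rightarrow> ('a \<times> 'a) set" where
  "nearest A = {(x, p). p \<in> A \<and> dist x p = infdist x A}"

text \<open>
  The image of \<open>X\<close> under the homotheties that contract each point towards a nearest point of
  \<open>A\<close>, with ratio \<open>\<mu>\<close>; all nearest points are used.
\<close>

definition contract :: "'a::real_normed_vector set \<Rightarrow> real \<Rightarrow> 'a set \<Rightarrow> 'a set" where
  "contract A \<mu> X = (\<lambda>(x, p). (1 - \<mu>) *\<^sub>R p + \<mu> *\<^sub>R x) ` {z \<in> nearest A. fst z \<in> X}"

lemma nearest_exists:
  fixes A :: "'a::heine_borel set"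
  assumes "compact A" "A \<noteq> {}"
  obtains p where "(x, p) \<in> nearest A"
proof -
  obtain p where "p \<in> A" "infdist x A = dist x p"
    using infdist_attains_inf[OF compact_imp_closed[OF assms(1)] assms(2)] .
  then show thesis by (intro that[of p]) (simp add: nearest_def)
qed

text \<open>
  Add up the inequalities which say that \<open>p\<close> is no farther from \<open>x\<close> than \<open>q\<close>, and \<open>q\<close> no
  farther from \<open>y\<close> than \<open>p\<close>.
\<close>

lemma nearest_monotone:
  fixes x y p q :: "'a::real_inner"
  assumes "(x, p) \<in> nearest A" "(y, q) \<in> nearest A"
  shows "0 \<le> (p - q) \<bullet> (x - y)"
proof -
  have "dist x p \<le> dist x q" "dist y q \<le> dist y p"
    using assms infdist_le[of q A x] infdist_le[of p A y] by (auto simp: nearest_def)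
  then have "(x - p) \<bullet> (x - p) \<le> (x - q) \<bullet> (x - q)" "(y - q) \<bullet> (y - q) \<le> (y - p) \<bullet> (y - p)"
    by (auto simp: dist_norm norm_le)
  then show ?thesis
    by (simp add: inner_diff_left inner_diff_right inner_commute)
qed

text \<open>
  After squaring and expanding both sides, the inequality holds term by term.
\<close>

lemma norm_segment_ratio:
  fixes u w :: "'a::real_inner"
  assumes "0 \<le> u \<bullet> w" "0 < \<mu>" "\<mu> \<le> \<nu>" "\<nu> \<le> 1"
  shows "norm ((1 - \<nu>) *\<^sub>R u + \<nu> *\<^sub>R w) \<le> \<nu> / \<mu> * norm ((1 - \<mu>) *\<^sub>R u + \<mu> *\<^sub>R w)"
proof -
  have sq: "(norm (c *\<^sub>R u + e *\<^sub>R w))\<^sup>2 = c\<^sup>2 * (u \<bullet> u) + 2 * (c * e) * (u \<bullet> w) + e\<^sup>2 * (w \<bullet> w)" for c e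
    unfolding power2_norm_eq_inner
    by (simp add: inner_add_left inner_add_right inner_commute power2_eq_square algebra_simps)
  have c: "\<mu> * (1 - \<nu>) \<le> \<nu> * (1 - \<mu>)" using assms by (simp add: algebra_simps)
  have "(\<mu> * (1 - \<nu>))\<^sup>2 \<le> (\<nu> * (1 - \<mu>))\<^sup>2"
    using c assms by (intro power_mono) auto
  then have 1: "(\<mu> * (1 - \<nu>))\<^sup>2 * (u \<bullet> u) \<le> (\<nu> * (1 - \<mu>))\<^sup>2 * (u \<bullet> u)"
    by (intro mult_right_mono) auto
  have "(\<mu> * \<nu>) * (\<mu> * (1 - \<nu>)) \<le> (\<mu> * \<nu>) * (\<nu> * (1 - \<mu>))"
    using c assms by (intro mult_left_mono) auto
  then have 2: "(\<mu> * \<nu>) * (\<mu> * (1 - \<nu>)) * (u \<bullet> w) \<le> (\<mu> * \<nu>) * (\<nu> * (1 - \<mu>)) * (u \<bullet> w)"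
    using assms(1) by (rule mult_right_mono)
  have "(\<mu> * norm ((1 - \<nu>) *\<^sub>R u + \<nu> *\<^sub>R w))\<^sup>2 \<le> (\<nu> * norm ((1 - \<mu>) *\<^sub>R u + \<mu> *\<^sub>R w))\<^sup>2"
    unfolding power_mult_distrib sq using 1 2
    by (simp add: power2_eq_square algebra_simps)
  then have "\<mu> * norm ((1 - \<nu>) *\<^sub>R u + \<nu> *\<^sub>R w) \<le> \<nu> * norm ((1 - \<mu>) *\<^sub>R u + \<mu> *\<^sub>R w)"
    by (rule power2_le_imp_le) (use assms in simp)
  then show ?thesis
    using \<open>0 < \<mu>\<close> by (simp add: pos_le_divide_eq mult.commute)
qed

lemma infdist_contract:
  fixes A :: "'a::real_normed_vector set"
  assumes "(x, p) \<in> nearest A" "0 \<le> \<mu>" "\<mu> \<le> 1"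
  shows "infdist ((1 - \<mu>) *\<^sub>R p + \<mu> *\<^sub>R x) A = \<mu> * infdist x A"
proof (rule antisym)
  let ?y = "(1 - \<mu>) *\<^sub>R p + \<mu> *\<^sub>R x"
  have p: "p \<in> A" "dist x p = infdist x A" using assms by (auto simp: nearest_def)
  have "?y - p = \<mu> *\<^sub>R (x - p)" by (simp add: algebra_simps)
  then have "dist ?y p = \<mu> * dist x p" using assms by (simp add: dist_norm)
  then show "infdist ?y A \<le> \<mu> * infdist x A" using infdist_le[OF p(1), of ?y] p(2) by simp
  have "x - ?y = (1 - \<mu>) *\<^sub>R (x - p)" by (simp add: algebra_simps)
  then have "dist x ?y = (1 - \<mu>) * dist x p" using assms by (simp add: dist_norm)
  then show "\<mu> * infdist x A \<le> infdist ?y A"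
    using infdist_triangle[of x A ?y] p(2) by (simp add: algebra_simps)
qed

lemma nearest_contract:
  fixes A :: "'a::real_normed_vector set"
  assumes "(x, p) \<in> nearest A" "0 \<le> \<mu>" "\<mu> \<le> 1"
  shows "((1 - \<mu>) *\<^sub>R p + \<mu> *\<^sub>R x, p) \<in> nearest A"
proof -
  have "(1 - \<mu>) *\<^sub>R p + \<mu> *\<^sub>R x - p = \<mu> *\<^sub>R (x - p)" by (simp add: algebra_simps)
  then have "dist ((1 - \<mu>) *\<^sub>R p + \<mu> *\<^sub>R x) p = \<mu> * dist x p" using assms by (simp add: dist_norm)
  then show ?thesis
    using infdist_contract[OF assms] assms(1) by (simp add: nearest_def)
qed

lemma contract_1:
  fixes A :: "'a::euclidean_space set"
  assumes "compact A" "A \<noteq> {}"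
  shows "contract A 1 X = X"
proof
  show "X \<subseteq> contract A 1 X"
  proof
    fix x assume "x \<in> X"
    obtain p where "(x, p) \<in> nearest A" using nearest_exists[OF assms] .
    then show "x \<in> contract A 1 X"
      using \<open>x \<in> X\<close> unfolding contract_def by (intro image_eqI[of _ _ "(x, p)"]) auto
  qed
qed (auto simp: contract_def)

lemma compact_contract:
  fixes A :: "'a::euclidean_space set"
  assumes "compact A" "compact X"
  shows "compact (contract A \<mu> X)"
proof -
  have "{z \<in> nearest A. fst z \<in> X} = (X \<times> A) \<inter> {z. dist (fst z) (snd z) = infdist (fst z) A}"
    by (auto simp: nearest_def)
  moreover have "closed {z::'a \<times> 'a. dist (fst z) (snd z) = infdist (fst z) A}"
    by (intro closed_Collect_eq continuous_intros)
  ultimately have "compact {z \<in> nearest A. fst z \<in> X}"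
    using assms by (simp add: compact_Times compact_Int_closed)
  then show ?thesis unfolding contract_def
    by (intro compact_continuous_image) (auto simp: case_prod_unfold intro!: continuous_intros)
qed

text \<open>
  The surjection moves a point along its segment from ratio \<open>\<mu>\<close> to ratio \<open>\<nu>\<close>. It is well
  defined because the assumed inequality applies to the difference of any two segments.
\<close>

lemma contract_lipschitz_surjection:
  fixes A :: "'a::euclidean_space set"
  assumes "0 \<le> L" and ratio: "\<And>u w :: 'a. 0 \<le> u \<bullet> w \<Longrightarrow>
      norm ((1 - \<nu>) *\<^sub>R u + \<nu> *\<^sub>R w) \<le> L * norm ((1 - \<mu>) *\<^sub>R u + \<mu> *\<^sub>R w)"
    and "\<And>x. x \<in> X \<Longrightarrow> infdist x A \<le> r"
  obtains f where "f ` contract A \<mu> X = contract A \<nu> X" "L-lipschitz_on (contract A \<mu> X) f"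
    "\<And>y. y \<in> contract A \<mu> X \<Longrightarrow> dist (f y) y \<le> \<bar>\<nu> - \<mu>\<bar> * r"
proof -
  define Z where "Z = {z \<in> nearest A. fst z \<in> X}"
  define g where "g \<kappa> = (\<lambda>(x, p). (1 - \<kappa>) *\<^sub>R p + \<kappa> *\<^sub>R x :: 'a)" for \<kappa>
  have c: "contract A \<kappa> X = g \<kappa> ` Z" for \<kappa> by (simp add: contract_def Z_def g_def)
  have g: "dist (g \<nu> z) (g \<nu> z') \<le> L * dist (g \<mu> z) (g \<mu> z')" if "z \<in> Z" "z' \<in> Z" for z z'
  proof -
    obtain x p x' p' where z: "z = (x, p)" "z' = (x', p')" by (cases z, cases z') auto
    have "dist (g \<kappa> z) (g \<kappa> z') = norm ((1 - \<kappa>) *\<^sub>R (p - p') + \<kappa> *\<^sub>R (x - x'))" for \<kappa>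
      by (simp add: z g_def dist_norm algebra_simps)
    then show ?thesis
      using nearest_monotone[of x p A x' p'] ratio that z by (simp add: Z_def)
  qed
  define f where "f y = g \<nu> (inv_into Z (g \<mu>) y)" for y
  have f: "f (g \<mu> z) = g \<nu> z" if "z \<in> Z" for z
  proof -
    have "inv_into Z (g \<mu>) (g \<mu> z) \<in> Z" "g \<mu> (inv_into Z (g \<mu>) (g \<mu> z)) = g \<mu> z"
      using that by (auto intro: inv_into_into f_inv_into_f)
    then show ?thesis using g[of "inv_into Z (g \<mu>) (g \<mu> z)" z] that by (simp add: f_def)
  qed
  show thesis
  proof (rule that)
    show "f ` contract A \<mu> X = contract A \<nu> X"
      using f by (force simp: c)
    show "L-lipschitz_on (contract A \<mu> X) f"
      using \<open>0 \<le> L\<close> f g by (auto simp: c lipschitz_on_def)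
    fix y assume "y \<in> contract A \<mu> X"
    then obtain z where z: "z \<in> Z" "y = g \<mu> z" by (auto simp: c)
    obtain x p where xp: "z = (x, p)" by (cases z)
    have "f y - y = (\<nu> - \<mu>) *\<^sub>R (x - p)"
      unfolding z(2) f[OF z(1)] by (simp add: xp g_def algebra_simps)
    then have "dist (f y) y = \<bar>\<nu> - \<mu>\<bar> * dist x p" by (simp add: dist_norm)
    also have "\<dots> \<le> \<bar>\<nu> - \<mu>\<bar> * r"
      using assms(3)[of x] z xp by (intro mult_left_mono) (auto simp: Z_def nearest_def)
    finally show "dist (f y) y \<le> \<bar>\<nu> - \<mu>\<bar> * r" .
  qed
qed

lemma contract_outward:
  fixes A :: "'a::euclidean_space set"
  assumes "0 < \<mu>" "\<mu> \<le> \<nu>" "\<nu> \<le> 1" "\<And>x. x \<in> X \<Longrightarrow> infdist x A \<le> r"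
  obtains f where "f ` contract A \<mu> X = contract A \<nu> X" "(\<nu> / \<mu>)-lipschitz_on (contract A \<mu> X) f"
    "\<And>y. y \<in> contract A \<mu> X \<Longrightarrow> dist (f y) y \<le> \<bar>\<nu> - \<mu>\<bar> * r"
  by (rule contract_lipschitz_surjection[of "\<nu> / \<mu>" \<nu> \<mu> X A r])
    (use assms norm_segment_ratio in auto)

text \<open>
  Exchanging the two end points of each segment turns ratio \<open>\<mu>\<close> into \<open>1 - \<mu>\<close> and reduces
  this case to \<open>norm_segment_ratio\<close> again.
\<close>

lemma contract_inward:
  fixes A :: "'a::euclidean_space set"
  assumes "0 \<le> \<nu>" "\<nu> \<le> \<mu>" "\<mu> < 1" "\<And>x. x \<in> X \<Longrightarrow> infdist x A \<le> r"
  obtains f where "f ` contract A \<mu> X = contract A \<nu> X"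
    "((1 - \<nu>) / (1 - \<mu>))-lipschitz_on (contract A \<mu> X) f"
    "\<And>y. y \<in> contract A \<mu> X \<Longrightarrow> dist (f y) y \<le> \<bar>\<nu> - \<mu>\<bar> * r"
proof (rule contract_lipschitz_surjection[of "(1 - \<nu>) / (1 - \<mu>)" \<nu> \<mu> X A r])
  fix u w :: 'a assume "0 \<le> u \<bullet> w"
  then show "norm ((1 - \<nu>) *\<^sub>R u + \<nu> *\<^sub>R w) \<le> (1 - \<nu>) / (1 - \<mu>) * norm ((1 - \<mu>) *\<^sub>R u + \<mu> *\<^sub>R w)"
    using norm_segment_ratio[of w u "1 - \<mu>" "1 - \<nu>"] assms
    by (simp add: inner_commute add.commute)
qed (use assms that in auto)

section \<open>Shells and the volume function\<close>

text \<open>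
  The closed shell of points whose distance to \<open>A\<close> lies between \<open>a\<close> and \<open>b\<close>. The level set at
  distance \<open>s\<close> is the degenerate shell with \<open>a = b = s\<close>.
\<close>

definition shell :: "'a::metric_space set \<Rightarrow> real \<Rightarrow> real \<Rightarrow> 'a set" where
  "shell A a b = {x. a \<le> infdist x A \<and> infdist x A \<le> b}"

lemma compact_shell:
  fixes A :: "'a::euclidean_space set"
  assumes "compact A" "A \<noteq> {}"
  shows "compact (shell A a b)"
proof -
  have "shell A a b = {x. infdist x A \<le> max b 1} \<inter> {x. a \<le> infdist x A} \<inter> {x. infdist x A \<le> b}"
    by (auto simp: shell_def)
  moreover have "closed {x. a \<le> infdist x A}" "closed {x. infdist x A \<le> b}"
    by (intro closed_Collect_le continuous_intros)+
  ultimately show ?thesis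
    using compact_infdist_le[OF assms(2,1), of "max b 1"] by (simp add: compact_Int_closed)
qed

lemma sets_shell [measurable]:
  fixes A :: "'a::euclidean_space set"
  assumes "compact A" "A \<noteq> {}"
  shows "shell A a b \<in> sets borel"
  using compact_shell[OF assms] by (simp add: borel_closed compact_imp_closed)

lemma contract_shell_subset:
  assumes "0 \<le> \<mu>" "\<mu> \<le> 1"
  shows "contract A \<mu> (shell A a b) \<subseteq> shell A (\<mu> * a) (\<mu> * b)"
  using assms by (auto simp: contract_def shell_def infdist_contract intro: mult_left_mono)

text \<open>Kneser's inequality, in a form that records which points of the inner shell are used.\<close>

lemma emeasure_shell_le_contract:
  fixes A :: "'a::euclidean_space set"
  assumes A: "compact A" "A \<noteq> {}" and \<mu>: "0 < \<mu>" "\<mu> \<le> 1"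
  shows "emeasure lborel (shell A a b)
    \<le> ennreal ((1 / \<mu>) ^ DIM('a)) * emeasure lborel (contract A \<mu> (shell A a b))"
proof -
  obtain f where f: "f ` contract A \<mu> (shell A a b) = contract A 1 (shell A a b)"
    "(1 / \<mu>)-lipschitz_on (contract A \<mu> (shell A a b)) f"
    by (rule contract_outward[of \<mu> 1 "shell A a b" A b]) (use \<mu> in \<open>simp_all add: shell_def\<close>)
  have "compact (contract A \<mu> (shell A a b))"
    using A by (intro compact_contract compact_shell)
  from emeasure_lborel_lipschitz_image[OF f(2) this] f(1) contract_1[OF A]
  show ?thesis by simp
qed

lemma parallel_set_sets [measurable]: "parallel_set A r \<in> sets borel"
  unfolding parallel_set_def
  by (intro borel_open open_Collect_less continuous_intros)

lemma emeasure_bounded_shell: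
  fixes A :: "'a::euclidean_space set"
  assumes "compact A" "A \<noteq> {}"
  shows "emeasure lborel (shell A a b) = ennreal (measure lborel (shell A a b))"
    and "emeasure lborel (parallel_set A r) = ennreal (parallel_volume A r)"
proof -
  have "emeasure lborel (shell A a b) < \<infinity>"
    using compact_shell[OF assms] by (rule emeasure_compact_finite)
  then show "emeasure lborel (shell A a b) = ennreal (measure lborel (shell A a b))"
    by (intro emeasure_eq_ennreal_measure) auto
  have "parallel_set A r \<subseteq> shell A 0 r"
    by (auto simp: parallel_set_def shell_def infdist_nonneg)
  then have "bounded (parallel_set A r)"
    using compact_imp_bounded[OF compact_shell[OF assms]] by (rule bounded_subset[rotated])
  then show "emeasure lborel (parallel_set A r) = ennreal (parallel_volume A r)"
    unfolding parallel_volume_def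
    by (intro emeasure_eq_ennreal_measure) (auto simp: top_unique dest: emeasure_bounded_finite)
qed

lemma fmeasurable_parallel:
  fixes A :: "'a::euclidean_space set"
  assumes "compact A" "A \<noteq> {}"
  shows "parallel_set A r \<in> fmeasurable lborel" "shell A a b \<in> fmeasurable lborel"
  using emeasure_bounded_shell[OF assms] sets_shell[OF assms]
  by (auto intro!: fmeasurableI)

lemma measure_shell_bounds:
  fixes A :: "'a::euclidean_space set"
  assumes "compact A" "A \<noteq> {}"
  shows "parallel_volume A b - parallel_volume A a \<le> measure lborel (shell A a b)"
    and "a \<le> c \<Longrightarrow> b < c \<Longrightarrow> measure lborel (shell A a b) \<le> parallel_volume A c - parallel_volume A a"
proof -
  note fm = fmeasurable_parallel[OF assms]
  have ms: "parallel_set A r \<in> sets lborel" "shell A a b \<in> sets lborel" for r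
    using fm by (auto simp: fmeasurable_def)
  have "parallel_set A b \<subseteq> parallel_set A a \<union> shell A a b"
    by (auto simp: parallel_set_def shell_def)
  then have "measure lborel (parallel_set A b) \<le> measure lborel (parallel_set A a \<union> shell A a b)"
    by (rule measure_mono_fmeasurable[OF _ ms(1) fmeasurable.Un[OF fm]])
  also have "\<dots> \<le> measure lborel (parallel_set A a) + measure lborel (shell A a b)"
    by (rule measure_Un_le[OF ms])
  finally show "parallel_volume A b - parallel_volume A a \<le> measure lborel (shell A a b)"
    by (simp add: parallel_volume_def)
  assume "a \<le> c" "b < c"
  have "parallel_set A a \<inter> shell A a b = {}"
    by (auto simp: parallel_set_def shell_def)
  then have "measure lborel (parallel_set A a) + measure lborel (shell A a b)
      = measure lborel (parallel_set A a \<union> shell A a b)"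
    by (simp add: measure_Un_AE[OF _ fm] disjoint_iff)
  also have "\<dots> \<le> measure lborel (parallel_set A c)"
  proof (rule measure_mono_fmeasurable[OF _ sets.Un[OF ms] fm(1)])
    show "parallel_set A a \<union> shell A a b \<subseteq> parallel_set A c"
      using \<open>b < c\<close> \<open>a \<le> c\<close> by (auto simp: parallel_set_def shell_def)
  qed
  finally show "measure lborel (shell A a b) \<le> parallel_volume A c - parallel_volume A a"
    by (simp add: parallel_volume_def)
qed

lemma parallel_volume_mono:
  fixes A :: "'a::euclidean_space set"
  assumes "compact A" "A \<noteq> {}" "a \<le> b"
  shows "parallel_volume A a \<le> parallel_volume A b"
proof -
  have "parallel_set A a \<subseteq> parallel_set A b"
    using assms(3) by (auto simp: parallel_set_def)
  then show ?thesis unfolding parallel_volume_def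
    using fmeasurable_parallel(1)[OF assms(1,2)]
    by (intro measure_mono_fmeasurable) (auto simp: parallel_set_sets)
qed

text \<open>
  The parallel sets are open, so the volume function is continuous from the left. This removes the
  boundary of the closed shells from Kneser's inequality.
\<close>

lemma parallel_volume_left_limit:
  fixes A :: "'a::euclidean_space set"
  assumes "compact A" "A \<noteq> {}" "h \<longlonglongrightarrow> b" "incseq h" "\<And>n. h n < b"
  shows "(\<lambda>n. parallel_volume A (h n)) \<longlonglongrightarrow> parallel_volume A b"
  unfolding parallel_volume_def
proof -
  have "(\<Union>n. parallel_set A (h n)) = parallel_set A b"
  proof
    show "(\<Union>n. parallel_set A (h n)) \<subseteq> parallel_set A b"
      using assms(5) by (force simp: parallel_set_def intro: less_trans)
    show "parallel_set A b \<subseteq> (\<Union>n. parallel_set A (h n))"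
    proof
      fix x assume "x \<in> parallel_set A b"
      then have "\<forall>\<^sub>F n in sequentially. infdist x A < h n"
        using assms(3) by (intro order_tendstoD) (auto simp: parallel_set_def)
      then show "x \<in> (\<Union>n. parallel_set A (h n))"
        by (auto simp: parallel_set_def dest: eventually_happens)
    qed
  qed
  moreover have "(\<lambda>n. measure lborel (parallel_set A (h n))) \<longlonglongrightarrow> measure lborel (\<Union>n. parallel_set A (h n))"
  proof (rule Lim_measure_incseq)
    show "incseq (\<lambda>n. parallel_set A (h n))"
      using assms(4) by (force simp: incseq_def parallel_set_def intro: less_le_trans)
    show "emeasure lborel (\<Union>n. parallel_set A (h n)) \<noteq> \<infinity>"
      unfolding calculation using emeasure_bounded_shell(2)[OF assms(1,2)] by simp
  qed auto
  ultimately show "(\<lambda>n. measure lborel (parallel_set A (h n))) \<longlonglongrightarrow> measure lborel (parallel_set A b)"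
    by simp
qed

text \<open>
  The contraction of ratio \<open>1 / l\<close> maps the shell between \<open>l a\<close> and \<open>l b\<close> into the one between
  \<open>a\<close> and \<open>b\<close>.
\<close>

lemma kneser_inequality:
  fixes A :: "'a::euclidean_space set"
  assumes A: "compact A" "A \<noteq> {}" and ab: "0 < a" "a < b" and l: "1 \<le> l"
  shows "parallel_volume A (l * b) - parallel_volume A (l * a)
    \<le> l ^ DIM('a) * (parallel_volume A b - parallel_volume A a)"
proof (rule LIMSEQ_le_const2)
  define h where "h n = b - (b - a) * inverse (real (Suc n))" for n
  have hb: "h n < b" for n
    using ab by (simp add: h_def)
  have mono: "incseq h"
    using ab by (auto simp: incseq_def h_def intro!: mult_left_mono le_imp_inverse_le)
  have ha: "a \<le> h n" for n
    using incseqD[OF mono, of 0 n] by (simp add: h_def)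
  have lim: "h \<longlonglongrightarrow> b"
    using tendsto_diff[OF tendsto_const tendsto_mult_right_zero[OF LIMSEQ_inverse_real_of_nat], of b "b - a"]
    by (simp add: h_def[abs_def])
  have "(\<lambda>n. parallel_volume A (l * h n)) \<longlonglongrightarrow> parallel_volume A (l * b)"
    using lim mono hb l
    by (intro parallel_volume_left_limit A tendsto_mult_left) (auto simp: incseq_def mult_left_mono)
  then show "(\<lambda>n. parallel_volume A (l * h n) - parallel_volume A (l * a))
      \<longlonglongrightarrow> parallel_volume A (l * b) - parallel_volume A (l * a)"
    by (intro tendsto_intros)
  show "\<exists>N. \<forall>n\<ge>N. parallel_volume A (l * h n) - parallel_volume A (l * a)
      \<le> l ^ DIM('a) * (parallel_volume A b - parallel_volume A a)"
  proof (intro exI allI impI)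
    fix n
    let ?S = "shell A (l * a) (l * h n)"
    have "contract A (1 / l) ?S \<subseteq> shell A (1 / l * (l * a)) (1 / l * (l * h n))"
      using l by (intro contract_shell_subset) auto
    then have sub: "contract A (1 / l) ?S \<subseteq> shell A a (h n)" using l by simp
    have "ennreal (measure lborel ?S) = emeasure lborel ?S"
      using emeasure_bounded_shell[OF A] by simp
    also have "\<dots> \<le> ennreal ((1 / (1 / l)) ^ DIM('a)) * emeasure lborel (contract A (1 / l) ?S)"
      using l by (intro emeasure_shell_le_contract A) auto
    also have "\<dots> \<le> ennreal (l ^ DIM('a)) * emeasure lborel (shell A a (h n))"
      using sub sets_shell[OF A] by (intro mult_mono emeasure_mono) auto
    also have "\<dots> = ennreal (l ^ DIM('a) * measure lborel (shell A a (h n)))"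
      using emeasure_bounded_shell[OF A] l by (simp add: ennreal_mult)
    finally have "measure lborel ?S \<le> l ^ DIM('a) * measure lborel (shell A a (h n))"
      using l by (subst (asm) ennreal_le_iff) auto
    moreover have "l ^ DIM('a) * measure lborel (shell A a (h n))
        \<le> l ^ DIM('a) * (parallel_volume A b - parallel_volume A a)"
      using measure_shell_bounds(2)[OF A, of a b "h n"] ab hb l by (intro mult_left_mono) auto
    ultimately show "parallel_volume A (l * h n) - parallel_volume A (l * a)
        \<le> l ^ DIM('a) * (parallel_volume A b - parallel_volume A a)"
      using measure_shell_bounds(1)[OF A, where a="l * a" and b="l * h n"] by linarith
  qed
qed

section \<open>Kneser functions\<close>

text \<open>
  The functions \<open>V\<close> in this section are only assumed to satisfy Kneser's inequality and, later on,
  to be monotone. The first step compares the increments of \<open>V\<close> over two intervals with the same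
  ratio \<open>\<rho>\<close> of end points.
\<close>

lemma kneser_slope_step:
  fixes V :: "real \<Rightarrow> real"
  assumes kneser: "\<And>l a b. 0 < a \<Longrightarrow> a < b \<Longrightarrow> 1 \<le> l \<Longrightarrow> V (l * b) - V (l * a) \<le> l ^ d * (V b - V a)"
    and "0 < a" "a \<le> x" "1 < \<rho>"
  shows "(V (\<rho> * x) - V x) * a ^ d \<le> x ^ d * (V (\<rho> * a) - V a)"
proof -
  have "V (x / a * (\<rho> * a)) - V (x / a * a) \<le> (x / a) ^ d * (V (\<rho> * a) - V a)"
    using assms by (intro kneser) auto
  then have "V (\<rho> * x) - V x \<le> x ^ d * (V (\<rho> * a) - V a) / a ^ d"
    using \<open>0 < a\<close> by (simp add: power_divide mult.commute)
  then show ?thesis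
    using \<open>0 < a\<close> by (simp add: pos_le_divide_eq)
qed

text \<open>
  Compare each of the \<open>m\<close> geometric steps with ratio \<open>\<rho>\<close> from \<open>u\<close> to \<open>\<rho> ^ m u\<close>, and each of
  the \<open>N\<close> steps from \<open>x\<close> to \<open>\<rho> ^ N x\<close>, with the single step from \<open>x\<close> to \<open>\<rho> x\<close>.
\<close>

lemma kneser_slope_grid:
  fixes V :: "real \<Rightarrow> real"
  assumes kneser: "\<And>l a b. 0 < a \<Longrightarrow> a < b \<Longrightarrow> 1 \<le> l \<Longrightarrow> V (l * b) - V (l * a) \<le> l ^ d * (V b - V a)"
    and "0 < d" "0 < u" "1 < \<rho>" "\<rho> ^ m * u \<le> x"
  shows "(V (\<rho> ^ N * x) - V x) * ((\<rho> ^ m * u) ^ d - u ^ d)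
    \<le> (V (\<rho> ^ m * u) - V u) * ((\<rho> ^ N * x) ^ d - x ^ d)"
proof -
  define c where "c = \<rho> ^ d - 1"
  define E where "E a = V (\<rho> * a) - V a" for a
  have c: "0 < c" using assms by (simp add: c_def one_less_power)
  have "0 < \<rho> ^ m" using assms by simp
  have pw: "1 \<le> \<rho> ^ j" for j using assms by (simp add: one_le_power)
  have "1 * u \<le> \<rho> ^ m * u" using pw[of m] assms by (intro mult_right_mono) auto
  then have x: "0 < x" using assms by linarith
  \<comment> \<open>the steps from \<open>u\<close> are at least as steep as the step at \<open>x\<close>, those from \<open>x\<close> at most as steep\<close>
  have low: "E x * ((\<rho> ^ i * u) ^ d - u ^ d) \<le> x ^ d * c * (V (\<rho> ^ i * u) - V u)"
    if "\<rho> ^ i * u \<le> x" for i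
    using that
  proof (induction i)
    case (Suc i)
    have "\<rho> ^ i * u \<le> \<rho> * (\<rho> ^ i * u)"
      using assms by simp
    then have le: "\<rho> ^ i * u \<le> x" using Suc.prems by simp
    have "E x * (\<rho> ^ i * u) ^ d \<le> x ^ d * E (\<rho> ^ i * u)"
      unfolding E_def by (rule kneser_slope_step[OF kneser]) (use assms le in auto)
    then have "c * (E x * (\<rho> ^ i * u) ^ d) \<le> c * (x ^ d * E (\<rho> ^ i * u))"
      using c by (intro mult_left_mono) auto
    with Suc.IH[OF le] show ?case
      by (simp add: c_def E_def power_mult_distrib algebra_simps)
  qed simp
  have up: "x ^ d * c * (V (\<rho> ^ j * x) - V x) \<le> E x * ((\<rho> ^ j * x) ^ d - x ^ d)" for j
  proof (induction j)
    case (Suc j)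
    have "E (\<rho> ^ j * x) * x ^ d \<le> (\<rho> ^ j * x) ^ d * E x"
      unfolding E_def
      by (rule kneser_slope_step[OF kneser]) (use assms x pw[of j] in auto)
    then have "c * (E (\<rho> ^ j * x) * x ^ d) \<le> c * ((\<rho> ^ j * x) ^ d * E x)"
      using c by (intro mult_left_mono) auto
    with Suc.IH show ?case
      by (simp add: c_def E_def power_mult_distrib algebra_simps)
  qed simp
  have nn: "0 \<le> (\<rho> ^ m * u) ^ d - u ^ d" "0 \<le> (\<rho> ^ N * x) ^ d - x ^ d"
    using pw[of m] pw[of N] assms x by (auto intro!: power_mono)
  have "x ^ d * c * ((V (\<rho> ^ N * x) - V x) * ((\<rho> ^ m * u) ^ d - u ^ d))
      \<le> E x * ((\<rho> ^ N * x) ^ d - x ^ d) * ((\<rho> ^ m * u) ^ d - u ^ d)"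
    using mult_right_mono[OF up[of N] nn(1)] by (simp only: mult.assoc)
  also have "\<dots> \<le> x ^ d * c * ((V (\<rho> ^ m * u) - V u) * ((\<rho> ^ N * x) ^ d - x ^ d))"
    using mult_right_mono[OF low[OF assms(5)] nn(2)] by (simp only: mult_ac)
  finally show ?thesis
    using c x by (simp add: mult_le_cancel_left_pos)
qed

text \<open>
  The slopes of \<open>V\<close> with respect to the variable \<open>r ^ d\<close> decrease, that is, \<open>V\<close> is a concave
  function of \<open>r ^ d\<close>. The interval from \<open>u\<close> to \<open>v\<close> is divided into \<open>m\<close> geometric steps, and
  the same ratio is used for a grid from \<open>x\<close> that overshoots \<open>y\<close> by less than one step; then
  \<open>m\<close> tends to infinity.
\<close>

lemma kneser_slope:
  fixes V :: "real \<Rightarrow> real"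
  assumes kneser: "\<And>l a b. 0 < a \<Longrightarrow> a < b \<Longrightarrow> 1 \<le> l \<Longrightarrow> V (l * b) - V (l * a) \<le> l ^ d * (V b - V a)"
    and mono: "mono V" and "0 < d" "0 < u" "u < v" "v \<le> x" "x < y"
  shows "(V y - V x) * (v ^ d - u ^ d) \<le> (V v - V u) * (y ^ d - x ^ d)"
proof (rule LIMSEQ_le_const)
  let ?\<rho> = "\<lambda>m. root m (v / u)"
  have "?\<rho> \<longlonglongrightarrow> 1" using assms by (intro LIMSEQ_root_const) auto
  then show "(\<lambda>m. (V v - V u) * ((?\<rho> m * y) ^ d - x ^ d)) \<longlonglongrightarrow> (V v - V u) * (y ^ d - x ^ d)"
    by (auto intro!: tendsto_eq_intros)
  show "\<exists>M. \<forall>m\<ge>M. (V y - V x) * (v ^ d - u ^ d) \<le> (V v - V u) * ((?\<rho> m * y) ^ d - x ^ d)"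
  proof (intro exI allI impI)
    fix m :: nat assume "1 \<le> m"
    then have m: "0 < m" by simp
    let ?r = "?\<rho> m"
    have r: "1 < ?r" using assms m by (simp add: real_root_gt_1_iff)
    have rm: "?r ^ m * u = v" using assms m by (simp add: real_root_pow_pos2)
    \<comment> \<open>the first grid point beyond \<open>y\<close>\<close>
    define N where "N = (LEAST n. y \<le> ?r ^ n * x)"
    have xp: "0 < x" using assms by linarith
    obtain n0 where "y / x < ?r ^ n0" using real_arch_pow[OF r] by blast
    then have "y \<le> ?r ^ n0 * x" using xp by (simp add: pos_divide_less_eq)
    then have N: "y \<le> ?r ^ N * x" unfolding N_def by (rule LeastI)
    have N': "?r ^ N * x \<le> ?r * y"
    proof (cases N)
      case 0
      then show ?thesis using N assms(7) by simp
    next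
      case (Suc n)
      then have "\<not> y \<le> ?r ^ n * x"
        using not_less_Least[of n "\<lambda>n. y \<le> ?r ^ n * x"] by (simp add: N_def)
      then show ?thesis using r Suc by simp
    qed
    have "(V y - V x) * (v ^ d - u ^ d) \<le> (V (?r ^ N * x) - V x) * (v ^ d - u ^ d)"
      using monoD[OF mono N] assms by (intro mult_right_mono) (auto intro: power_mono)
    also have "\<dots> \<le> (V v - V u) * ((?r ^ N * x) ^ d - x ^ d)"
      using kneser_slope_grid[OF kneser assms(3,4) r, of m x N] rm assms(6) by simp
    also have "\<dots> \<le> (V v - V u) * ((?r * y) ^ d - x ^ d)"
      using N' N assms xp monoD[OF mono, of u v]
      by (intro mult_left_mono diff_right_mono power_mono) auto
    finally show "(V y - V x) * (v ^ d - u ^ d) \<le> (V v - V u) * ((?r * y) ^ d - x ^ d)" .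
  qed
qed

text \<open>
  Here \<open>g\<close> is the derivative of \<open>V\<close> at \<open>r\<close> with respect to \<open>r ^ d\<close>.
\<close>

lemma kneser_strictly_differentiable:
  fixes V :: "real \<Rightarrow> real"
  assumes kneser: "\<And>l a b. 0 < a \<Longrightarrow> a < b \<Longrightarrow> 1 \<le> l \<Longrightarrow> V (l * b) - V (l * a) \<le> l ^ d * (V b - V a)"
    and mono: "mono V" and d: "0 < d" and "0 < r" and diff: "V differentiable (at r)"
  obtains g where "0 \<le> g" "\<And>\<eta>. 0 < \<eta> \<Longrightarrow> \<exists>a b. 0 < a \<and> a < r \<and> r < b \<and>
    (\<forall>x y. a \<le> x \<longrightarrow> x < y \<longrightarrow> y \<le> b \<longrightarrow>
      (g - \<eta>) * (y ^ d - x ^ d) \<le> V y - V x \<and> V y - V x \<le> (g + \<eta>) * (y ^ d - x ^ d))"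
proof -
  define q where "q u v = (V v - V u) / (v ^ d - u ^ d)" for u v
  obtain D where D: "(V has_real_derivative D) (at r)"
    using diff by (auto simp: real_differentiable_def)
  define g where "g = D / (real d * r ^ (d - 1))"
  have pw: "((\<lambda>x. x ^ d) has_real_derivative (real d * r ^ (d - 1))) (at r)"
    by (auto intro!: derivative_eq_intros)
  have nz: "real d * r ^ (d - 1) \<noteq> 0" using assms by simp
  have "((\<lambda>u. ((V u - V r) / (u - r)) / ((u ^ d - r ^ d) / (u - r))) \<longlongrightarrow> g) (at r)"
    unfolding g_def using D pw nz
    by (intro tendsto_divide) (auto simp: has_field_derivative_iff)
  moreover have "\<forall>\<^sub>F u in at r. ((V u - V r) / (u - r)) / ((u ^ d - r ^ d) / (u - r)) = q r u"
    by (auto simp: eventually_at_filter q_def)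
  ultimately have lim: "((\<lambda>u. q r u) \<longlongrightarrow> g) (at r)"
    by (rule Lim_transform_eventually)
  have qsym: "q u v = q v u" for u v
    unfolding q_def by (metis minus_diff_eq minus_divide_divide)
  have cont: "((\<lambda>v. q u v) \<longlongrightarrow> q u r) (at r)" if "0 < u" "u \<noteq> r" for u
  proof -
    have "isCont V r" using D by (rule DERIV_isCont)
    moreover have "r ^ d - u ^ d \<noteq> 0"
      using that assms power_eq_iff_eq_base[of d r u] by auto
    ultimately show ?thesis unfolding q_def isCont_def
      by (intro tendsto_intros) auto
  qed
  have pos: "0 < y ^ d - x ^ d" if "0 < x" "x < y" for x y :: real
    using that d by (simp add: power_strict_mono)
  have qle: "q x y \<le> q u v" if "0 < u" "u < v" "v \<le> x" "x < y" for u v x y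
    using kneser_slope[OF kneser mono d that] pos[of u v] pos[of x y] that
    unfolding q_def by (simp add: divide_le_eq pos_le_divide_eq mult.commute)
  have q0: "0 \<le> q u v" if "0 < u" "u < v" for u v
    using monoD[OF mono, of u v] pos[OF that] that by (simp add: q_def)
  show thesis
  proof (rule that)
    show "0 \<le> g"
    proof (rule tendsto_lowerbound[OF filterlim_mono[OF lim order_refl at_le[of "{r<..}"]]])
      show "\<forall>\<^sub>F u in at r within {r<..}. 0 \<le> q r u"
        using q0 \<open>0 < r\<close> by (auto simp: eventually_at_filter)
    qed auto
    fix \<eta> :: real assume \<eta>: "0 < \<eta>"
    have "\<forall>\<^sub>F u in at_left r. q r u < g + \<eta>"
      using \<eta> lim by (intro order_tendstoD) (auto simp: filterlim_at_split)
    moreover have "\<forall>\<^sub>F u in at_left r. 0 < u" "\<forall>\<^sub>F u in at_left r. u < r"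
      using \<open>0 < r\<close> by (auto simp: eventually_at_left_field intro: exI[of _ 0])
    ultimately have "\<forall>\<^sub>F u in at_left r. q r u < g + \<eta> \<and> 0 < u \<and> u < r"
      by eventually_elim auto
    then obtain u where u: "q u r < g + \<eta>" "0 < u" "u < r"
      using eventually_happens'[OF trivial_limit_at_left_real] unfolding qsym[of r] by blast
    have "\<forall>\<^sub>F v in at_left r. q u v < g + \<eta>"
      using cont[of u] u by (intro order_tendstoD) (auto simp: filterlim_at_split)
    moreover have "\<forall>\<^sub>F v in at_left r. u < v" "\<forall>\<^sub>F v in at_left r. v < r"
      using u by (auto simp: eventually_at_left_field intro: exI[of _ u])
    ultimately have "\<forall>\<^sub>F v in at_left r. q u v < g + \<eta> \<and> u < v \<and> v < r"
      by eventually_elim auto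
    then obtain a where a: "q u a < g + \<eta>" "u < a" "a < r"
      using eventually_happens'[OF trivial_limit_at_left_real] by blast
    have "\<forall>\<^sub>F v in at_right r. g - \<eta> < q r v"
      using \<eta> lim by (intro order_tendstoD) (auto simp: filterlim_at_split)
    moreover have "\<forall>\<^sub>F v in at_right r. r < v"
      by (auto simp: eventually_at_right_field intro: exI[of _ "r + 1"])
    ultimately have "\<forall>\<^sub>F v in at_right r. g - \<eta> < q r v \<and> r < v"
      by eventually_elim auto
    then obtain v where v: "g - \<eta> < q v r" "r < v"
      using eventually_happens'[OF trivial_limit_at_right_real] unfolding qsym[of r] by blast
    have "\<forall>\<^sub>F b in at_right r. g - \<eta> < q v b"
      using cont[of v] v \<open>0 < r\<close> by (intro order_tendstoD) (auto simp: filterlim_at_split)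
    moreover have "\<forall>\<^sub>F b in at_right r. r < b" "\<forall>\<^sub>F b in at_right r. b < v"
      using v by (auto simp: eventually_at_right_field intro: exI[of _ v])
    ultimately have "\<forall>\<^sub>F b in at_right r. g - \<eta> < q b v \<and> r < b \<and> b < v"
      by eventually_elim (simp add: qsym[of v])
    then obtain b where b: "g - \<eta> < q b v" "r < b" "b < v"
      using eventually_happens'[OF trivial_limit_at_right_real] by blast
    have "(g - \<eta>) * (y ^ d - x ^ d) \<le> V y - V x \<and> V y - V x \<le> (g + \<eta>) * (y ^ d - x ^ d)"
      if xy: "a \<le> x" "x < y" "y \<le> b" for x y
    proof -
      have x: "0 < x" using u a xy by linarith
      have "q x y \<le> g + \<eta>" using qle[of u a x y] a u xy by linarith
      moreover have "g - \<eta> \<le> q x y" using qle[of x y b v] b x xy by linarith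
      ultimately show ?thesis
        using pos[OF x xy(2)] by (simp add: q_def pos_le_divide_eq pos_divide_le_eq)
    qed
    then show "\<exists>a b. 0 < a \<and> a < r \<and> r < b \<and>
      (\<forall>x y. a \<le> x \<longrightarrow> x < y \<longrightarrow> y \<le> b \<longrightarrow>
        (g - \<eta>) * (y ^ d - x ^ d) \<le> V y - V x \<and> V y - V x \<le> (g + \<eta>) * (y ^ d - x ^ d))"
      using a u b by (intro exI[of _ a] exI[of _ b]) auto
  qed
qed

section \<open>Surface measure of level sets\<close>

lemma power_diff_le:
  fixes x y b :: real
  assumes "0 \<le> x" "x \<le> y" "y \<le> b"
  shows "y ^ n - x ^ n \<le> real n * b ^ (n - 1) * (y - x)"
proof (induction n)
  case (Suc n)
  have b: "0 \<le> b" using assms by linarith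
  have xn: "x ^ n \<le> b ^ n" using assms by (intro power_mono) auto
  have "y * (y ^ n - x ^ n) \<le> b * (y ^ n - x ^ n)"
    using assms by (intro mult_right_mono) (auto intro: power_mono)
  also have "\<dots> \<le> b * (real n * b ^ (n - 1) * (y - x))"
    using Suc b by (rule mult_left_mono)
  also have "\<dots> = real n * b ^ n * (y - x)"
    by (cases n) auto
  finally have 1: "y * (y ^ n - x ^ n) \<le> real n * b ^ n * (y - x)" .
  have "(y - x) * x ^ n \<le> (y - x) * b ^ n"
    using xn assms by (intro mult_left_mono) auto
  with 1 show ?case by (simp add: algebra_simps)
qed simp

text \<open>
  A point at distance \<open>r\<close> is a limit of points at smaller distance, namely on the segment to a
  nearest point.
\<close>

lemma frontier_parallel_set:
  fixes A :: "'a::euclidean_space set"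
  assumes A: "compact A" "A \<noteq> {}" and "0 < r"
  shows "frontier (parallel_set A r) = shell A r r"
proof -
  have op: "open (parallel_set A r)"
    unfolding parallel_set_def by (intro open_Collect_less continuous_intros)
  have "closure (parallel_set A r) = {x. infdist x A \<le> r}"
  proof
    have "closed {x. infdist x A \<le> r}"
      by (intro closed_Collect_le continuous_intros)
    then show "closure (parallel_set A r) \<subseteq> {x. infdist x A \<le> r}"
      by (intro closure_minimal) (auto simp: parallel_set_def)
    show "{x. infdist x A \<le> r} \<subseteq> closure (parallel_set A r)"
    proof
      fix x assume "x \<in> {x. infdist x A \<le> r}"
      then have x: "infdist x A \<le> r" by simp
      obtain p where p: "(x, p) \<in> nearest A" using nearest_exists[OF A] .
      \<comment> \<open>a sequence in the parallel set that approaches \<open>x\<close> along the segment from a nearest point \<open>p\<close>\<close>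
      define y where "y n = (1 - (1 - inverse (real (Suc n)))) *\<^sub>R p + (1 - inverse (real (Suc n))) *\<^sub>R x" for n
      have "y n \<in> parallel_set A r" for n
      proof -
        have i: "0 < inverse (real (Suc n))" "inverse (real (Suc n)) \<le> 1"
          by (simp_all add: inverse_le_1_iff)
        have "infdist (y n) A = (1 - inverse (real (Suc n))) * infdist x A"
          unfolding y_def using i by (intro infdist_contract[OF p]) auto
        also have "\<dots> \<le> (1 - inverse (real (Suc n))) * r"
          using x i by (intro mult_left_mono) auto
        also have "\<dots> < r" using i \<open>0 < r\<close> by simp
        finally show ?thesis by (simp add: parallel_set_def)
      qed
      moreover have "y \<longlonglongrightarrow> (1 - (1 - 0)) *\<^sub>R p + (1 - 0) *\<^sub>R x"
        unfolding y_def by (intro tendsto_intros LIMSEQ_inverse_real_of_nat)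
      ultimately show "x \<in> closure (parallel_set A r)"
        unfolding closure_sequential by (intro exI[of _ y]) simp
    qed
  qed
  then show ?thesis
    using op by (auto simp: frontier_def interior_open parallel_set_def shell_def)
qed

lemma UN_cball_subset_shell:
  assumes "K \<subseteq> shell A s s"
  shows "(\<Union>x\<in>K. cball x \<rho>) \<subseteq> shell A (s - \<rho>) (s + \<rho>)"
proof
  fix z assume "z \<in> (\<Union>x\<in>K. cball x \<rho>)"
  then obtain x where x: "x \<in> K" "dist x z \<le> \<rho>" by auto
  then have "infdist x A = s" using assms by (auto simp: shell_def)
  then show "z \<in> shell A (s - \<rho>) (s + \<rho>)"
    using infdist_triangle[of x A z] infdist_triangle[of z A x] x(2)
    by (simp add: shell_def dist_commute)
qed

lemma measure_shell_le:
  fixes A :: "'a::euclidean_space set"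
  assumes A: "compact A" "A \<noteq> {}"
    and up: "\<And>x y. a \<le> x \<Longrightarrow> x < y \<Longrightarrow> y \<le> b \<Longrightarrow>
      parallel_volume A y - parallel_volume A x \<le> G * (y ^ DIM('a) - x ^ DIM('a))"
    and "a \<le> x" "x \<le> y" "y < b"
  shows "measure lborel (shell A x y) \<le> G * (y ^ DIM('a) - x ^ DIM('a))"
proof (rule tendsto_lowerbound)
  show "((\<lambda>z. G * (z ^ DIM('a) - x ^ DIM('a))) \<longlongrightarrow> G * (y ^ DIM('a) - x ^ DIM('a))) (at_right y)"
    by (intro tendsto_intros)
  have "measure lborel (shell A x y) \<le> G * (z ^ DIM('a) - x ^ DIM('a))" if "y < z" "z < b" for z
    using measure_shell_bounds(2)[OF A, of x z y] up[of x z] assms(4-6) that by linarith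
  then show "\<forall>\<^sub>F z in at_right y. measure lborel (shell A x y) \<le> G * (z ^ DIM('a) - x ^ DIM('a))"
    using \<open>y < b\<close> unfolding eventually_at_right_field by blast
qed simp

lemma eventually_at_right_0_less:
  fixes c :: real
  assumes "0 < c"
  shows "\<forall>\<^sub>F \<rho> in at_right 0. \<rho> < c"
  using assms unfolding eventually_at_right_field by blast

lemma hausdorff_level_le:
  fixes A :: "'a::euclidean_space set" and G :: real
  defines "C \<equiv> 5 ^ (DIM('a) - 1) * unit_ball_vol (real (DIM('a) - 1)) / unit_ball_vol (real DIM('a))"
  assumes A: "compact A" "A \<noteq> {}" and "0 \<le> G"
    and up: "\<And>x y. a \<le> x \<Longrightarrow> x < y \<Longrightarrow> y \<le> b \<Longrightarrow>
      parallel_volume A y - parallel_volume A x \<le> G * (y ^ DIM('a) - x ^ DIM('a))"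
    and s: "0 < a" "a < s" "s < b"
  shows "hausdorff_outer (DIM('a) - 1) (shell A s s)
    \<le> ennreal (C * (2 * G * DIM('a) * b ^ (DIM('a) - 1)))"
  unfolding C_def
proof (rule hausdorff_outer_le_minkowski[OF compact_shell[OF A]])
  show "0 \<le> 2 * G * DIM('a) * b ^ (DIM('a) - 1)" using assms by simp
  have "\<forall>\<^sub>F \<rho> in at_right 0. 0 < \<rho> \<and> \<rho> < s - a \<and> \<rho> < b - s"
    using s by (intro eventually_conj eventually_at_right_0_less eventually_at_right_less) auto
  then show "\<forall>\<^sub>F \<rho> in at_right 0. emeasure lborel (\<Union>x\<in>shell A s s. cball x \<rho>)
      \<le> ennreal (2 * G * DIM('a) * b ^ (DIM('a) - 1) * \<rho>)"
  proof eventually_elim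
    fix \<rho> assume \<rho>: "0 < \<rho> \<and> \<rho> < s - a \<and> \<rho> < b - s"
    have "emeasure lborel (\<Union>x\<in>shell A s s. cball x \<rho>) \<le> emeasure lborel (shell A (s - \<rho>) (s + \<rho>))"
      using sets_shell[OF A] by (intro emeasure_mono UN_cball_subset_shell) auto
    also have "\<dots> = ennreal (measure lborel (shell A (s - \<rho>) (s + \<rho>)))"
      by (rule emeasure_bounded_shell[OF A])
    also have "\<dots> \<le> ennreal (2 * G * DIM('a) * b ^ (DIM('a) - 1) * \<rho>)"
    proof (rule ennreal_leI)
      have "measure lborel (shell A (s - \<rho>) (s + \<rho>)) \<le> G * ((s + \<rho>) ^ DIM('a) - (s - \<rho>) ^ DIM('a))"
        using \<rho> by (intro measure_shell_le[OF A up]) auto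
      also have "\<dots> \<le> G * (DIM('a) * b ^ (DIM('a) - 1) * ((s + \<rho>) - (s - \<rho>)))"
        using \<rho> s \<open>0 \<le> G\<close> by (intro mult_left_mono power_diff_le) auto
      finally show "measure lborel (shell A (s - \<rho>) (s + \<rho>)) \<le> 2 * G * DIM('a) * b ^ (DIM('a) - 1) * \<rho>"
        by (simp add: mult_ac)
    qed
    finally show "emeasure lborel (\<Union>x\<in>shell A s s. cball x \<rho>)
      \<le> ennreal (2 * G * DIM('a) * b ^ (DIM('a) - 1) * \<rho>)" .
  qed
qed

text \<open>
  The points at distance \<open>s\<close> from \<open>A\<close> that lie on a segment from a point at distance \<open>t\<close> to one
  of its nearest points in \<open>A\<close>. The definition is meant for \<open>0 < s \<le> t\<close>.
\<close>

definition extendible :: "'a::real_normed_vector set \<Rightarrow> real \<Rightarrow> real \<Rightarrow> 'a set" where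
  "extendible A t s = contract A (s / t) (shell A t t)"

lemma extendible_subset:
  assumes "0 < s" "s \<le> t"
  shows "extendible A t s \<subseteq> shell A s s"
  using contract_shell_subset[of "s / t" A t t] assms by (simp add: extendible_def)

lemma compact_extendible:
  fixes A :: "'a::euclidean_space set"
  assumes "compact A" "A \<noteq> {}"
  shows "compact (extendible A t s)"
  unfolding extendible_def using assms by (intro compact_contract compact_shell)

text \<open>
  Points of the shell between \<open>x\<close> and \<open>y\<close> whose segments extend to level \<open>t\<close> or beyond are close
  to extendible points of level \<open>s\<close>: shift them along their segments.
\<close>

lemma dist_contract_extendible:
  fixes A :: "'a::euclidean_space set"
  assumes x: "0 < x" "x \<le> s" "s \<le> y" "s \<le> t" and z: "z \<in> contract A (x / t) (shell A t (t * y / x))"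
  obtains z' where "z' \<in> extendible A t s" "dist z z' \<le> max (s - x) (y - s)"
proof -
  obtain w p where w: "(w, p) \<in> nearest A" "t \<le> infdist w A" "infdist w A \<le> t * y / x"
    and zw: "z = (1 - x / t) *\<^sub>R p + (x / t) *\<^sub>R w"
    using z by (auto simp: contract_def shell_def)
  define \<tau> where "\<tau> = infdist w A"
  have \<tau>: "t \<le> \<tau>" "\<tau> * x \<le> t * y" "0 < \<tau>" "0 < t"
    using w x by (auto simp: \<tau>_def pos_le_divide_eq)
  \<comment> \<open>the point of the same segment at level \<open>t\<close>; it still has \<open>p\<close> as a nearest point\<close>
  define w' where "w' = (1 - t / \<tau>) *\<^sub>R p + (t / \<tau>) *\<^sub>R w"
  have t\<tau>: "0 \<le> t / \<tau>" "t / \<tau> \<le> 1" using \<tau> by auto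
  have "(w', p) \<in> nearest A" "infdist w' A = t"
    using nearest_contract[OF w(1) t\<tau>] infdist_contract[OF w(1) t\<tau>] \<tau>
    by (auto simp: w'_def \<tau>_def)
  then have mem: "(1 - s / t) *\<^sub>R p + (s / t) *\<^sub>R w' \<in> extendible A t s"
    unfolding extendible_def contract_def by (intro image_eqI[of _ _ "(w', p)"]) (auto simp: shell_def)
  have eq: "(1 - s / t) *\<^sub>R p + (s / t) *\<^sub>R w' = p + (s / \<tau>) *\<^sub>R (w - p)"
    using \<tau> by (simp add: w'_def algebra_simps)
  have "z - ((1 - s / t) *\<^sub>R p + (s / t) *\<^sub>R w') = (x / t - s / \<tau>) *\<^sub>R (w - p)"
    unfolding eq by (simp add: zw algebra_simps)
  then have "dist z ((1 - s / t) *\<^sub>R p + (s / t) *\<^sub>R w') = \<bar>x / t - s / \<tau>\<bar> * \<tau>"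
    using w(1) by (simp add: dist_norm nearest_def \<tau>_def)
  also have "\<dots> = \<bar>(x / t - s / \<tau>) * \<tau>\<bar>" using \<tau> by (simp add: abs_mult)
  also have "(x / t - s / \<tau>) * \<tau> = \<tau> * x / t - s" using \<tau> by (simp add: left_diff_distrib)
  also have "\<bar>\<tau> * x / t - s\<bar> \<le> max (s - x) (y - s)"
  proof -
    have "\<tau> * x / t \<le> y" using \<tau> by (simp add: pos_divide_le_eq mult.commute)
    moreover have "x \<le> \<tau> * x / t" using \<tau> x by (simp add: pos_le_divide_eq mult.commute)
    ultimately show ?thesis by linarith
  qed
  finally show thesis using mem by (rule that[rotated])
qed

text \<open>
  The number \<open>t y / x\<close> is chosen so that the contraction of ratio \<open>x / t\<close> takes the shell between
  \<open>t\<close> and \<open>t y / x\<close> into the shell between \<open>x\<close> and \<open>y\<close>. The volume lost in the contraction is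
  exactly compensated by the homogeneity of \<open>y ^ d - x ^ d\<close>.
\<close>

lemma measure_contract_ge:
  fixes A :: "'a::euclidean_space set"
  assumes A: "compact A" "A \<noteq> {}"
    and low: "\<And>x y. a \<le> x \<Longrightarrow> x < y \<Longrightarrow> y \<le> b \<Longrightarrow>
      G * (y ^ DIM('a) - x ^ DIM('a)) \<le> parallel_volume A y - parallel_volume A x"
    and x: "0 < x" "x < y" "x \<le> t" "a \<le> t" "t * y / x \<le> b"
  shows "G * (y ^ DIM('a) - x ^ DIM('a)) \<le> measure lborel (contract A (x / t) (shell A t (t * y / x)))"
proof -
  let ?S = "shell A t (t * y / x)" and ?d = "DIM('a)"
  have t: "0 < t" using x by linarith
  have c: "compact (contract A (x / t) ?S)" using A by (intro compact_contract compact_shell)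
  have "t < t * y / x" using x t by (simp add: pos_less_divide_eq)
  then have "G * ((t * y / x) ^ ?d - t ^ ?d) \<le> measure lborel ?S"
    using low[of t "t * y / x"] measure_shell_bounds(1)[OF A, where a=t and b="t * y / x"] x by linarith
  also have "measure lborel ?S \<le> (t / x) ^ ?d * measure lborel (contract A (x / t) ?S)"
  proof -
    have "ennreal (measure lborel ?S) \<le> ennreal ((1 / (x / t)) ^ ?d) * emeasure lborel (contract A (x / t) ?S)"
      unfolding emeasure_bounded_shell[OF A, symmetric] using x t
      by (intro emeasure_shell_le_contract A) auto
    also have "emeasure lborel (contract A (x / t) ?S) = ennreal (measure lborel (contract A (x / t) ?S))"
      using emeasure_compact_finite[OF c] by (intro emeasure_eq_ennreal_measure) auto
    also have "ennreal ((1 / (x / t)) ^ ?d) * \<dots> = ennreal ((t / x) ^ ?d * measure lborel (contract A (x / t) ?S))"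
      using x t by (simp add: ennreal_mult)
    finally show ?thesis
      using x t by (subst (asm) ennreal_le_iff) auto
  qed
  finally have le: "(x / t) ^ ?d * (G * ((t * y / x) ^ ?d - t ^ ?d))
      \<le> (x / t) ^ ?d * ((t / x) ^ ?d * measure lborel (contract A (x / t) ?S))"
    using x t by (intro mult_left_mono) auto
  have eq: "(x / t) ^ ?d * (G * ((t * y / x) ^ ?d - t ^ ?d)) = G * (y ^ ?d - x ^ ?d)"
  proof -
    have "(x / t) ^ ?d * (t * y / x) ^ ?d = y ^ ?d" "(x / t) ^ ?d * t ^ ?d = x ^ ?d"
      unfolding power_mult_distrib[symmetric] using x t by simp_all
    then show ?thesis by (metis (no_types, lifting) mult.left_commute right_diff_distrib)
  qed
  have "(x / t) ^ ?d * (t / x) ^ ?d = 1"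
    unfolding power_mult_distrib[symmetric] using x t by simp
  then have "(x / t) ^ ?d * ((t / x) ^ ?d * c) = c" for c
    unfolding mult.assoc[symmetric] by simp
  with le show ?thesis unfolding eq by simp
qed

text \<open>
  Small neighbourhoods of \<open>K\<close> and the part of the surrounding shell whose segments extend to level
  \<open>t\<close> are disjoint subsets of the shell. The two slope bounds leave little volume for the former.
\<close>

lemma hausdorff_away_from_extendible_le:
  fixes A K :: "'a::euclidean_space set" and g \<eta> :: real
  defines "C \<equiv> 5 ^ (DIM('a) - 1) * unit_ball_vol (real (DIM('a) - 1)) / unit_ball_vol (real DIM('a))"
  assumes A: "compact A" "A \<noteq> {}" and "0 \<le> \<eta>"
    and up: "\<And>x y. a \<le> x \<Longrightarrow> x < y \<Longrightarrow> y \<le> b \<Longrightarrow>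
      parallel_volume A y - parallel_volume A x \<le> (g + \<eta>) * (y ^ DIM('a) - x ^ DIM('a))"
    and low: "\<And>x y. a \<le> x \<Longrightarrow> x < y \<Longrightarrow> y \<le> b \<Longrightarrow>
      (g - \<eta>) * (y ^ DIM('a) - x ^ DIM('a)) \<le> parallel_volume A y - parallel_volume A x"
    and s: "0 < a" "a < s" "s < t" "t < b"
    and K: "compact K" "K \<subseteq> shell A s s"
    and "0 < \<delta>" and sep: "\<And>x y. x \<in> K \<Longrightarrow> y \<in> extendible A t s \<Longrightarrow> \<delta> \<le> dist x y"
  shows "hausdorff_outer (DIM('a) - 1) K \<le> ennreal (C * (4 * \<eta> * DIM('a) * b ^ (DIM('a) - 1)))"
  unfolding C_def
proof (rule hausdorff_outer_le_minkowski[OF K(1)])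
  show "0 \<le> 4 * \<eta> * DIM('a) * b ^ (DIM('a) - 1)" using assms by simp
  have "((\<lambda>\<rho>. t * (s + \<rho>) / (s - \<rho>)) \<longlongrightarrow> t * (s + 0) / (s - 0)) (at_right 0)"
    using s by (intro tendsto_intros) auto
  then have "\<forall>\<^sub>F \<rho> in at_right 0. t * (s + \<rho>) / (s - \<rho>) < b"
    using s by (intro order_tendstoD) auto
  then have "\<forall>\<^sub>F \<rho> in at_right 0. 0 < \<rho> \<and> \<rho> < s - a \<and> \<rho> < b - s \<and> \<rho> < \<delta> / 2 \<and> t * (s + \<rho>) / (s - \<rho>) < b"
    using s \<open>0 < \<delta>\<close> by (intro eventually_conj eventually_at_right_0_less eventually_at_right_less) auto
  then show "\<forall>\<^sub>F \<rho> in at_right 0. emeasure lborel (\<Union>x\<in>K. cball x \<rho>)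
      \<le> ennreal (4 * \<eta> * DIM('a) * b ^ (DIM('a) - 1) * \<rho>)"
  proof eventually_elim
    fix \<rho> assume "0 < \<rho> \<and> \<rho> < s - a \<and> \<rho> < b - s \<and> \<rho> < \<delta> / 2 \<and> t * (s + \<rho>) / (s - \<rho>) < b"
    then have \<rho>: "0 < \<rho>" "\<rho> < s - a" "\<rho> < b - s" "\<rho> < \<delta> / 2" "t * (s + \<rho>) / (s - \<rho>) \<le> b"
      by auto
    let ?x = "s - \<rho>" and ?y = "s + \<rho>"
    let ?N = "\<Union>x\<in>K. cball x \<rho>" and ?Q = "contract A (?x / t) (shell A t (t * ?y / ?x))"
    have x: "0 < ?x" using \<rho> s by linarith
    have cN: "compact ?N" using K(1) by (rule compact_UN_cball)
    have cQ: "compact ?Q" using A by (intro compact_contract compact_shell)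
    have fm: "?N \<in> fmeasurable lborel" "?Q \<in> fmeasurable lborel"
      using cN cQ by (auto intro!: fmeasurable_compact)
    have "?Q \<subseteq> shell A (?x / t * t) (?x / t * (t * ?y / ?x))"
      using \<rho> s x by (intro contract_shell_subset) auto
    then have Q: "?Q \<subseteq> shell A ?x ?y" using s x by simp
    have N: "?N \<subseteq> shell A ?x ?y" using K(2) by (rule UN_cball_subset_shell)
    have disj: "?N \<inter> ?Q = {}"
    proof (rule ccontr)
      assume "?N \<inter> ?Q \<noteq> {}"
      then obtain k z where kz: "k \<in> K" "dist k z \<le> \<rho>" "z \<in> ?Q" by auto
      obtain z' where z': "z' \<in> extendible A t s" "dist z z' \<le> max (s - ?x) (?y - s)"
        using dist_contract_extendible[OF x _ _ _ kz(3), of s] \<rho> s by auto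
      then have "dist k z' \<le> 2 * \<rho>" using dist_triangle[of k z' z] kz(2) by simp
      then show False using sep[OF kz(1) z'(1)] \<rho> by linarith
    qed
    have "measure lborel ?N + measure lborel ?Q = measure lborel (?N \<union> ?Q)"
      using disj by (intro measure_Un_AE[symmetric, OF AE_I2 fm]) blast
    also have "\<dots> \<le> measure lborel (shell A ?x ?y)"
      using N Q fm by (intro measure_mono_fmeasurable fmeasurable_parallel A)
        (auto simp: fmeasurable_def)
    also have "\<dots> \<le> (g + \<eta>) * (?y ^ DIM('a) - ?x ^ DIM('a))"
      using \<rho> s by (intro measure_shell_le[OF A up]) auto
    finally have "measure lborel ?N + measure lborel ?Q \<le> (g + \<eta>) * (?y ^ DIM('a) - ?x ^ DIM('a))" .
    moreover have "(g - \<eta>) * (?y ^ DIM('a) - ?x ^ DIM('a)) \<le> measure lborel ?Q"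
      using \<rho> s x by (intro measure_contract_ge[OF A low]) auto
    ultimately have "measure lborel ?N \<le> (2 * \<eta>) * (?y ^ DIM('a) - ?x ^ DIM('a))"
      by (simp add: algebra_simps)
    also have "\<dots> \<le> (2 * \<eta>) * (DIM('a) * b ^ (DIM('a) - 1) * (?y - ?x))"
      using \<rho> s \<open>0 \<le> \<eta>\<close> by (intro mult_left_mono power_diff_le) auto
    finally have "measure lborel ?N \<le> 4 * \<eta> * DIM('a) * b ^ (DIM('a) - 1) * \<rho>"
      by (simp add: mult_ac)
    moreover have "emeasure lborel ?N = ennreal (measure lborel ?N)"
      using emeasure_compact_finite[OF cN] by (intro emeasure_eq_ennreal_measure) auto
    ultimately show "emeasure lborel ?N \<le> ennreal (4 * \<eta> * DIM('a) * b ^ (DIM('a) - 1) * \<rho>)"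
      by (simp add: ennreal_leI)
  qed
qed

text \<open>
  The set of extendible points may be nowhere dense in the level set, so that neighbourhoods
  of its complement need not be small in volume. The complement is therefore exhausted by compact
  sets at positive distance from the extendible points.
\<close>

lemma hausdorff_non_extendible_le:
  fixes A :: "'a::euclidean_space set" and g \<eta> :: real
  defines "C \<equiv> 5 ^ (DIM('a) - 1) * unit_ball_vol (real (DIM('a) - 1)) / unit_ball_vol (real DIM('a))"
  assumes A: "compact A" "A \<noteq> {}" and "0 \<le> \<eta>"
    and up: "\<And>x y. a \<le> x \<Longrightarrow> x < y \<Longrightarrow> y \<le> b \<Longrightarrow>
      parallel_volume A y - parallel_volume A x \<le> (g + \<eta>) * (y ^ DIM('a) - x ^ DIM('a))"
    and low: "\<And>x y. a \<le> x \<Longrightarrow> x < y \<Longrightarrow> y \<le> b \<Longrightarrow>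
      (g - \<eta>) * (y ^ DIM('a) - x ^ DIM('a)) \<le> parallel_volume A y - parallel_volume A x"
    and s: "0 < a" "a < s" "s < t" "t < b"
  shows "emeasure (hausdorff_measure (DIM('a) - 1)) (shell A s s - extendible A t s)
    \<le> ennreal (C * (4 * \<eta> * DIM('a) * b ^ (DIM('a) - 1)))"
proof -
  let ?H = "hausdorff_measure (DIM('a) - 1) :: 'a measure" and ?R = "extendible A t s"
  define K where "K n = shell A s s \<inter> (\<Inter>y\<in>?R. {x. inverse (real (Suc n)) \<le> dist x y})" for n
  have cK: "compact (K n)" for n
    unfolding K_def
    by (intro compact_Int_closed compact_shell A closed_INT ballI closed_Collect_le continuous_intros)
  have mK: "K n \<in> sets ?H" for n
    using cK by (simp add: borel_closed compact_imp_closed)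
  have clR: "closed ?R" by (intro compact_imp_closed compact_extendible A)
  have "(\<Union>n. K n) = shell A s s - ?R"
  proof
    show "(\<Union>n. K n) \<subseteq> shell A s s - ?R"
    proof
      fix x assume "x \<in> (\<Union>n. K n)"
      then obtain n where n: "x \<in> shell A s s" "\<And>y. y \<in> ?R \<Longrightarrow> inverse (real (Suc n)) \<le> dist x y"
        by (auto simp: K_def)
      then show "x \<in> shell A s s - ?R"
        using n(2)[of x] by (auto simp del: of_nat_Suc)
    qed
    show "shell A s s - ?R \<subseteq> (\<Union>n. K n)"
    proof
      fix x assume x: "x \<in> shell A s s - ?R"
      then obtain e where e: "0 < e" "\<And>y. y \<in> ?R \<Longrightarrow> e \<le> dist x y"
        using separate_point_closed[OF clR, of x] by auto
      obtain n where "inverse (real (Suc n)) < e" using reals_Archimedean[OF e(1)] by blast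
      then have "inverse (real (Suc n)) \<le> dist x y" if "y \<in> ?R" for y
        using e(2)[OF that] by linarith
      then have "x \<in> K n" using x by (simp add: K_def)
      then show "x \<in> (\<Union>n. K n)" by blast
    qed
  qed
  moreover have "(SUP n. emeasure ?H (K n)) = emeasure ?H (\<Union>n. K n)"
  proof (rule SUP_emeasure_incseq)
    show "range K \<subseteq> sets ?H" using mK by blast
    show "incseq K"
    proof (rule incseq_SucI)
      fix n
      have "inverse (real (Suc (Suc n))) \<le> inverse (real (Suc n))" by (rule le_imp_inverse_le) auto
      then show "K n \<subseteq> K (Suc n)" unfolding K_def by (blast intro: order_trans)
    qed
  qed
  moreover have "emeasure ?H (K n) \<le> ennreal (C * (4 * \<eta> * DIM('a) * b ^ (DIM('a) - 1)))" for n
  proof -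
    have "emeasure ?H (K n) = hausdorff_outer (DIM('a) - 1) (K n)"
      using mK by (intro emeasure_hausdorff_measure) simp
    also have "\<dots> \<le> ennreal (C * (4 * \<eta> * DIM('a) * b ^ (DIM('a) - 1)))"
      unfolding C_def
    proof (rule hausdorff_away_from_extendible_le[OF A \<open>0 \<le> \<eta>\<close> up low s cK])
      show "K n \<subseteq> shell A s s" by (simp add: K_def)
      show "0 < inverse (real (Suc n))" by simp
      show "inverse (real (Suc n)) \<le> dist x y" if "x \<in> K n" "y \<in> ?R" for x y
        using that unfolding K_def by blast
    qed
    finally show ?thesis .
  qed
  ultimately show ?thesis
    using SUP_least[of UNIV "\<lambda>n. emeasure ?H (K n)"] by metis
qed

section \<open>Integrals over level sets\<close>

lemma parallel_surface_measure_eq_density: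
  fixes A :: "'a::euclidean_space set"
  assumes A: "compact A" "A \<noteq> {}" and "0 < r"
  shows "parallel_surface_measure A r
    = density (hausdorff_measure (DIM('a) - 1)) (indicator (shell A r r))"
proof (rule measure_eqI)
  fix B assume "B \<in> sets (parallel_surface_measure A r)"
  then have B: "B \<in> sets borel" by simp
  then show "emeasure (parallel_surface_measure A r) B
      = emeasure (density (hausdorff_measure (DIM('a) - 1)) (indicator (shell A r r))) B"
    using sets_shell[OF A]
    by (simp add: emeasure_parallel_surface_measure frontier_parallel_set[OF assms] emeasure_density
        indicator_inter_arith[symmetric])
qed simp

lemma nn_integral_lipschitz_image_le:
  fixes \<phi> :: "'a::euclidean_space \<Rightarrow> 'a"
  assumes E: "compact E" and lip: "L-lipschitz_on E \<phi>" and f: "f \<in> borel_measurable borel"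
  shows "(\<integral>\<^sup>+x. f x * indicator (\<phi> ` E) x \<partial>hausdorff_measure k)
    \<le> ennreal (L ^ k) * (\<integral>\<^sup>+x. f (\<phi> x) * indicator E x \<partial>hausdorff_measure k)"
proof -
  let ?H = "hausdorff_measure k :: 'a measure"
  have cont: "continuous_on E \<phi>" using lip by (rule lipschitz_on_continuous_on)
  have E': "E \<in> sets ?H" and F: "\<phi> ` E \<in> sets ?H"
    using E compact_continuous_image[OF cont E] by (simp_all add: borel_closed compact_imp_closed)
  have "\<phi> \<in> borel_measurable (restrict_space borel E)"
    using cont by (rule borel_measurable_continuous_on_restrict)
  then have \<phi>: "\<phi> \<in> restrict_space ?H E \<rightarrow>\<^sub>M borel"
    by (simp cong: measurable_cong_sets add: sets_restrict_space_cong[of ?H borel])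
  let ?M = "density ?H (indicator (\<phi> ` E))" and ?N = "distr (restrict_space ?H E) borel \<phi>"
  have "?M \<le> scale_measure (ennreal (L ^ k)) ?N"
  proof (rule le_measure[THEN iffD2])
    show "\<forall>B\<in>sets ?M. emeasure ?M B \<le> emeasure (scale_measure (ennreal (L ^ k)) ?N) B"
    proof
      fix B assume "B \<in> sets ?M"
      then have B: "B \<in> sets borel" by simp
      have pre: "\<phi> -` B \<inter> E \<in> sets ?H"
        using measurable_sets[OF \<phi> B] E' by (simp add: space_restrict_space sets_restrict_space_iff)
      have eq: "\<phi> ` E \<inter> B = \<phi> ` (\<phi> -` B \<inter> E)" by auto
      have FB: "\<phi> ` E \<inter> B \<in> sets borel" using F B by simp
      have "emeasure ?M B = emeasure ?H (\<phi> ` E \<inter> B)"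
        using B F by (simp add: emeasure_density indicator_inter_arith[symmetric])
      also have "\<dots> = hausdorff_outer k (\<phi> ` (\<phi> -` B \<inter> E))"
        using emeasure_hausdorff_measure[OF FB] unfolding eq .
      also have "\<dots> \<le> ennreal (L ^ k) * hausdorff_outer k (\<phi> -` B \<inter> E)"
        by (intro hausdorff_outer_lipschitz_image lipschitz_on_subset[OF lip]) auto
      also have "hausdorff_outer k (\<phi> -` B \<inter> E) = emeasure ?H (\<phi> -` B \<inter> E)"
        using pre by (simp add: emeasure_hausdorff_measure)
      also have "\<dots> = emeasure ?N B"
        using B E' \<phi> by (simp add: emeasure_distr emeasure_restrict_space space_restrict_space)
      finally show "emeasure ?M B \<le> emeasure (scale_measure (ennreal (L ^ k)) ?N) B" by simp
    qed
  qed simp_all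
  then have "nn_integral ?M f \<le> nn_integral (scale_measure (ennreal (L ^ k)) ?N) f"
    by (intro nn_integral_mono_measure) simp_all
  also have "\<dots> = ennreal (L ^ k) * nn_integral ?N f"
    using f by (intro nn_integral_scale_measure) simp
  also have "nn_integral ?N f = (\<integral>\<^sup>+x. f (\<phi> x) * indicator E x \<partial>?H)"
    using f \<phi> E' by (simp add: nn_integral_distr nn_integral_restrict_space)
  also have "nn_integral ?M f = (\<integral>\<^sup>+x. f x * indicator (\<phi> ` E) x \<partial>?H)"
    using f F by (subst nn_integral_density) (auto simp: mult.commute)
  finally show ?thesis .
qed

text \<open>
  On extendible points, transport along the segments from level \<open>s\<close> to level \<open>s'\<close> multiplies
  measures by at most \<open>\<Lambda> ^ (d - 1)\<close> and increases the values of \<open>f\<close> by at most \<open>e\<close>; elsewhere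
  \<open>f\<close> is bounded by \<open>M\<close>. The levels \<open>s\<close> and \<open>s'\<close> may come in either order.
\<close>

lemma nn_integral_level_le:
  fixes A :: "'a::euclidean_space set" and f :: "'a \<Rightarrow> real"
  defines "H \<equiv> hausdorff_measure (DIM('a) - 1) :: 'a measure"
  assumes A: "compact A" "A \<noteq> {}" and s: "0 < s" "s < t" "0 < s'" "s' < t"
    and f: "continuous_on UNIV f" "\<And>x. 0 \<le> f x" "\<And>x. f x \<le> M"
    and close: "\<And>x y. x \<in> shell A s s \<Longrightarrow> y \<in> shell A s' s' \<Longrightarrow> dist x y \<le> \<bar>s' - s\<bar> \<Longrightarrow> f y \<le> f x + e"
    and "0 \<le> e" and \<Lambda>: "s' / s \<le> \<Lambda>" "(t - s') / (t - s) \<le> \<Lambda>"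
  shows "(\<integral>\<^sup>+x. ennreal (f x) * indicator (shell A s' s') x \<partial>H)
    \<le> ennreal (\<Lambda> ^ (DIM('a) - 1)) *
        ((\<integral>\<^sup>+x. ennreal (f x) * indicator (shell A s s) x \<partial>H) + ennreal e * emeasure H (shell A s s))
      + ennreal M * emeasure H (shell A s' s' - extendible A t s')"
proof -
  let ?R = "extendible A t s" and ?R' = "extendible A t s'" and ?L = "shell A s s" and ?L' = "shell A s' s'"
  let ?k = "DIM('a) - 1"
  have sH[simp, measurable_cong]: "sets H = sets borel" by (simp add: H_def)
  have [measurable]: "f \<in> borel_measurable borel" using f(1) by (rule borel_measurable_continuous_onI)
  have cR: "compact ?R" "compact ?R'" using A by (auto intro: compact_extendible)
  have [measurable]: "?R \<in> sets borel" "?R' \<in> sets borel" "?L \<in> sets borel" "?L' \<in> sets borel"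
    using cR sets_shell[OF A] by (auto simp: borel_closed compact_imp_closed)
  have sub: "?R \<subseteq> ?L" "?R' \<subseteq> ?L'" using s by (simp_all add: extendible_subset)
  have t: "0 < t" using s by linarith
  obtain \<phi> where \<phi>: "\<phi> ` ?R = ?R'" "\<Lambda>-lipschitz_on ?R \<phi>" "\<And>y. y \<in> ?R \<Longrightarrow> dist (\<phi> y) y \<le> \<bar>s' / t - s / t\<bar> * t"
  proof (cases "s \<le> s'")
    case True
    obtain \<phi> where "\<phi> ` ?R = ?R'" "(s' / t / (s / t))-lipschitz_on ?R \<phi>"
      "\<And>y. y \<in> ?R \<Longrightarrow> dist (\<phi> y) y \<le> \<bar>s' / t - s / t\<bar> * t"
      unfolding extendible_def
      by (rule contract_outward[of "s / t" "s' / t" "shell A t t" A t])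
        (use s t True in \<open>simp_all add: divide_right_mono shell_def\<close>)
    moreover have "s' / t / (s / t) \<le> \<Lambda>" using \<Lambda>(1) t by simp
    ultimately show thesis using lipschitz_on_le by (intro that[of \<phi>]) auto
  next
    case False
    obtain \<phi> where "\<phi> ` ?R = ?R'" "((1 - s' / t) / (1 - s / t))-lipschitz_on ?R \<phi>"
      "\<And>y. y \<in> ?R \<Longrightarrow> dist (\<phi> y) y \<le> \<bar>s' / t - s / t\<bar> * t"
      unfolding extendible_def
      by (rule contract_inward[of "s' / t" "s / t" "shell A t t" A t])
        (use s t False in \<open>simp_all add: divide_right_mono shell_def\<close>)
    moreover have "(1 - s' / t) / (1 - s / t) = (t - s') / (t - s)"
    proof -
      have "(1 - s' / t) / (1 - s / t) = ((t - s') / t) / ((t - s) / t)"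
        using t by (simp add: diff_divide_distrib)
      then show ?thesis using t by simp
    qed
    ultimately show thesis using \<Lambda>(2) lipschitz_on_le by (intro that[of \<phi>]) auto
  qed
  have \<phi>f: "f (\<phi> y) \<le> f y + e" if "y \<in> ?R" for y
  proof (rule close)
    show "y \<in> ?L" "\<phi> y \<in> ?L'" using that \<phi>(1) sub by auto
    have "\<bar>s' / t - s / t\<bar> * t = \<bar>s' - s\<bar>"
      using t by (simp add: diff_divide_distrib[symmetric])
    then show "dist y (\<phi> y) \<le> \<bar>s' - s\<bar>" using \<phi>(3)[OF that] by (simp add: dist_commute)
  qed
  have "(\<integral>\<^sup>+x. ennreal (f x) * indicator ?R' x \<partial>H)
      \<le> ennreal (\<Lambda> ^ ?k) * (\<integral>\<^sup>+x. ennreal (f (\<phi> x)) * indicator ?R x \<partial>H)"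
    using nn_integral_lipschitz_image_le[OF cR(1) \<phi>(2), of "\<lambda>x. ennreal (f x)" ?k] \<phi>(1)
    by (simp add: H_def)
  also have "(\<integral>\<^sup>+x. ennreal (f (\<phi> x)) * indicator ?R x \<partial>H)
      \<le> (\<integral>\<^sup>+x. ennreal (f x) * indicator ?L x + ennreal e * indicator ?L x \<partial>H)"
  proof (intro nn_integral_mono)
    fix x
    show "ennreal (f (\<phi> x)) * indicator ?R x \<le> ennreal (f x) * indicator ?L x + ennreal e * indicator ?L x"
    proof (cases "x \<in> ?R")
      case True
      then have "x \<in> ?L" using sub by blast
      then show ?thesis using True ennreal_leI[OF \<phi>f[OF True]] f(2)[of x] \<open>0 \<le> e\<close> by simp
    qed simp
  qed
  also have "\<dots> = (\<integral>\<^sup>+x. ennreal (f x) * indicator ?L x \<partial>H) + ennreal e * emeasure H ?L"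
    by (subst nn_integral_add) (simp_all add: nn_integral_cmult_indicator)
  finally have 1: "(\<integral>\<^sup>+x. ennreal (f x) * indicator ?R' x \<partial>H) \<le> ennreal (\<Lambda> ^ ?k) *
      ((\<integral>\<^sup>+x. ennreal (f x) * indicator ?L x \<partial>H) + ennreal e * emeasure H ?L)"
    by (simp add: mult_left_mono)
  have "(\<integral>\<^sup>+x. ennreal (f x) * indicator ?L' x \<partial>H)
      = (\<integral>\<^sup>+x. ennreal (f x) * indicator ?R' x + ennreal (f x) * indicator (?L' - ?R') x \<partial>H)"
    using sub by (intro nn_integral_cong) (auto simp: indicator_def)
  also have "\<dots> = (\<integral>\<^sup>+x. ennreal (f x) * indicator ?R' x \<partial>H)
      + (\<integral>\<^sup>+x. ennreal (f x) * indicator (?L' - ?R') x \<partial>H)"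
    by (rule nn_integral_add) simp_all
  also have "(\<integral>\<^sup>+x. ennreal (f x) * indicator (?L' - ?R') x \<partial>H) \<le> (\<integral>\<^sup>+x. ennreal M * indicator (?L' - ?R') x \<partial>H)"
    using f(3) by (intro nn_integral_mono mult_right_mono ennreal_leI) auto
  also have "\<dots> = ennreal M * emeasure H (?L' - ?R')"
    by (simp add: nn_integral_cmult_indicator)
  finally show ?thesis using 1 by (meson add_mono order_refl order_trans add_left_mono add_right_mono)
qed

lemma integral_parallel_surface_measure:
  fixes A :: "'a::euclidean_space set" and f :: "'a \<Rightarrow> real"
  assumes A: "compact A" "A \<noteq> {}" and "0 < s"
    and f: "continuous_on UNIV f" "\<And>x. 0 \<le> f x"
  shows "(\<integral>x. f x \<partial>parallel_surface_measure A s)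
    = enn2real (\<integral>\<^sup>+x. ennreal (f x) * indicator (shell A s s) x \<partial>hausdorff_measure (DIM('a) - 1))"
proof -
  have m: "f \<in> borel_measurable borel" using f(1) by (rule borel_measurable_continuous_onI)
  then have m': "f \<in> borel_measurable (parallel_surface_measure A s)"
    by (simp cong: measurable_cong_sets)
  have "(\<integral>x. f x \<partial>parallel_surface_measure A s) = enn2real (\<integral>\<^sup>+x. ennreal (f x) \<partial>parallel_surface_measure A s)"
    using m' f(2) by (intro integral_eq_nn_integral) auto
  also have "(\<integral>\<^sup>+x. ennreal (f x) \<partial>parallel_surface_measure A s)
      = (\<integral>\<^sup>+x. ennreal (f x) * indicator (shell A s s) x \<partial>hausdorff_measure (DIM('a) - 1))"
    unfolding parallel_surface_measure_eq_density[OF A \<open>0 < s\<close>]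
    using m sets_shell[OF A] by (subst nn_integral_density) (auto simp: mult.commute)
  finally show ?thesis .
qed

section \<open>Continuity at differentiability points of the volume function\<close>

lemma parallel_volume_strictly_differentiable:
  fixes A :: "'a::euclidean_space set"
  assumes A: "compact A" "A \<noteq> {}" and "0 < r" and "parallel_volume A differentiable (at r)"
  obtains g where "0 \<le> g" "\<And>\<eta>. 0 < \<eta> \<Longrightarrow> \<exists>a b. 0 < a \<and> a < r \<and> r < b \<and>
    (\<forall>x y. a \<le> x \<longrightarrow> x < y \<longrightarrow> y \<le> b \<longrightarrow>
      (g - \<eta>) * (y ^ DIM('a) - x ^ DIM('a)) \<le> parallel_volume A y - parallel_volume A x \<and>
      parallel_volume A y - parallel_volume A x \<le> (g + \<eta>) * (y ^ DIM('a) - x ^ DIM('a)))"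
proof (rule kneser_strictly_differentiable[of "parallel_volume A" "DIM('a)" r])
  show "mono (parallel_volume A)" using parallel_volume_mono[OF A] by (rule monoI)
  show "parallel_volume A (l * b) - parallel_volume A (l * a)
      \<le> l ^ DIM('a) * (parallel_volume A b - parallel_volume A a)" if "0 < a" "a < b" "1 \<le> l" for l a b
    by (rule kneser_inequality[OF A that])
qed (use assms that in auto)

lemma level_measure_locally_bounded:
  fixes A :: "'a::euclidean_space set"
  assumes A: "compact A" "A \<noteq> {}" and "0 < r" and "parallel_volume A differentiable (at r)"
  obtains a b B where "0 < a" "a < r" "r < b" "0 \<le> B"
    "\<And>s. a < s \<Longrightarrow> s < b \<Longrightarrow> emeasure (hausdorff_measure (DIM('a) - 1)) (shell A s s) \<le> ennreal B"
proof -
  obtain g where g: "0 \<le> g" and strict: "\<And>\<eta>. 0 < \<eta> \<Longrightarrow> \<exists>a b. 0 < a \<and> a < r \<and> r < b \<and>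
    (\<forall>x y. a \<le> x \<longrightarrow> x < y \<longrightarrow> y \<le> b \<longrightarrow>
      (g - \<eta>) * (y ^ DIM('a) - x ^ DIM('a)) \<le> parallel_volume A y - parallel_volume A x \<and>
      parallel_volume A y - parallel_volume A x \<le> (g + \<eta>) * (y ^ DIM('a) - x ^ DIM('a)))"
    using parallel_volume_strictly_differentiable[OF assms] by blast
  obtain a b where ab: "0 < a" "a < r" "r < b" and up: "\<And>x y. a \<le> x \<Longrightarrow> x < y \<Longrightarrow> y \<le> b \<Longrightarrow>
      parallel_volume A y - parallel_volume A x \<le> (g + 1) * (y ^ DIM('a) - x ^ DIM('a))"
    using strict[of 1] by auto
  define B where "B = 5 ^ (DIM('a) - 1) * unit_ball_vol (real (DIM('a) - 1)) / unit_ball_vol (real DIM('a))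
    * (2 * (g + 1) * DIM('a) * b ^ (DIM('a) - 1))"
  show thesis
  proof (rule that[OF ab])
    show "0 \<le> B" using g ab by (simp add: B_def)
    fix s assume "a < s" "s < b"
    moreover have "emeasure (hausdorff_measure (DIM('a) - 1)) (shell A s s) = hausdorff_outer (DIM('a) - 1) (shell A s s)"
      using sets_shell[OF A] by (rule emeasure_hausdorff_measure)
    ultimately show "emeasure (hausdorff_measure (DIM('a) - 1)) (shell A s s) \<le> ennreal B"
      using hausdorff_level_le[OF A _ up ab(1)] g by (simp add: B_def)
  qed
qed

lemma finite_borel_parallel_surface_measure:
  fixes A :: "'a::euclidean_space set"
  assumes A: "compact A" "A \<noteq> {}" "0 < s"
    and B: "emeasure (hausdorff_measure (DIM('a) - 1)) (shell A s s) \<le> ennreal B"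
  shows "finite_borel (parallel_surface_measure A s)"
proof -
  have sp: "space (parallel_surface_measure A s) = UNIV"
    using sets_eq_imp_space_eq[OF sets_parallel_surface_measure[of A s]] by simp
  have "emeasure (parallel_surface_measure A s) UNIV
      = emeasure (hausdorff_measure (DIM('a) - 1)) (shell A s s)"
    by (simp add: emeasure_parallel_surface_measure frontier_parallel_set[OF A])
  also have "\<dots> \<noteq> top" using B by (auto simp: top_unique)
  finally show ?thesis
    unfolding finite_borel_def by (intro conjI finite_measureI) (simp_all add: sp)
qed

text \<open>
  Given \<open>\<epsilon>\<close>, one level \<open>t > r\<close> serves for all \<open>s\<close> in a neighbourhood of \<open>r\<close>.
\<close>

lemma non_extendible_measure_small:
  fixes A :: "'a::euclidean_space set"
  assumes A: "compact A" "A \<noteq> {}" and "0 < r" and "parallel_volume A differentiable (at r)"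
    and "0 < \<epsilon>"
  obtains a t where "0 < a" "a < r" "r < t"
    "\<And>s. a < s \<Longrightarrow> s < t \<Longrightarrow>
      emeasure (hausdorff_measure (DIM('a) - 1)) (shell A s s - extendible A t s) \<le> ennreal \<epsilon>"
proof -
  let ?d = "DIM('a)"
  define C where "C = 5 ^ (?d - 1) * unit_ball_vol (real (?d - 1)) / unit_ball_vol (real ?d)"
  define c where "c = C * (4 * ?d * (r + 1) ^ (?d - 1))"
  have C: "0 \<le> C" by (simp add: C_def)
  have c: "0 \<le> c" using C \<open>0 < r\<close> by (simp add: c_def)
  define \<eta> where "\<eta> = \<epsilon> / (c + 1)"
  have \<eta>: "0 < \<eta>" using c \<open>0 < \<epsilon>\<close> by (simp add: \<eta>_def)
  have "(c + 1) * \<eta> = \<epsilon>" using c by (simp add: \<eta>_def)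
  then have c\<eta>: "c * \<eta> \<le> \<epsilon>" using \<eta> by (simp add: distrib_right)
  obtain g where "0 \<le> g" and strict: "\<And>\<eta>. 0 < \<eta> \<Longrightarrow> \<exists>a b. 0 < a \<and> a < r \<and> r < b \<and>
    (\<forall>x y. a \<le> x \<longrightarrow> x < y \<longrightarrow> y \<le> b \<longrightarrow>
      (g - \<eta>) * (y ^ DIM('a) - x ^ DIM('a)) \<le> parallel_volume A y - parallel_volume A x \<and>
      parallel_volume A y - parallel_volume A x \<le> (g + \<eta>) * (y ^ DIM('a) - x ^ DIM('a)))"
    using parallel_volume_strictly_differentiable[OF A assms(3,4)] by blast
  obtain a b0 where ab0: "0 < a" "a < r" "r < b0" and
    bd: "\<And>x y. a \<le> x \<Longrightarrow> x < y \<Longrightarrow> y \<le> b0 \<Longrightarrow>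
      (g - \<eta>) * (y ^ ?d - x ^ ?d) \<le> parallel_volume A y - parallel_volume A x \<and>
      parallel_volume A y - parallel_volume A x \<le> (g + \<eta>) * (y ^ ?d - x ^ ?d)"
    using strict[OF \<eta>] by blast
  \<comment> \<open>the bound \<open>r + 1\<close> makes the constant \<open>c\<close> independent of \<open>b0\<close>, hence of \<open>\<eta>\<close>\<close>
  define b where "b = min b0 (r + 1)"
  define t where "t = (r + b) / 2"
  have b: "r < b" "b \<le> b0" "b \<le> r + 1" using ab0 by (auto simp: b_def)
  have t: "r < t" "t < b" using b by (auto simp: t_def)
  show thesis
  proof (rule that[OF ab0(1,2) t(1)])
    fix s assume s: "a < s" "s < t"
    have up: "parallel_volume A y - parallel_volume A x \<le> (g + \<eta>) * (y ^ ?d - x ^ ?d)"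
      and low: "(g - \<eta>) * (y ^ ?d - x ^ ?d) \<le> parallel_volume A y - parallel_volume A x"
      if "a \<le> x" "x < y" "y \<le> b" for x y
      using bd[of x y] that b by auto
    have "emeasure (hausdorff_measure (?d - 1)) (shell A s s - extendible A t s)
        \<le> ennreal (C * (4 * \<eta> * ?d * b ^ (?d - 1)))"
      unfolding C_def
      by (rule hausdorff_non_extendible_le[OF A less_imp_le[OF \<eta>] up low ab0(1) s t(2)])
    also have "\<dots> \<le> ennreal \<epsilon>"
    proof (rule ennreal_leI)
      have "b ^ (?d - 1) \<le> (r + 1) ^ (?d - 1)" using b \<open>0 < r\<close> by (intro power_mono) auto
      then have "C * (4 * \<eta> * ?d * b ^ (?d - 1)) \<le> C * (4 * \<eta> * ?d * (r + 1) ^ (?d - 1))"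
        using C \<eta> by (intro mult_left_mono) auto
      also have "\<dots> = c * \<eta>" by (simp add: c_def)
      finally show "C * (4 * \<eta> * ?d * b ^ (?d - 1)) \<le> \<epsilon>" using c\<eta> by linarith
    qed
    finally show "emeasure (hausdorff_measure (?d - 1)) (shell A s s - extendible A t s) \<le> ennreal \<epsilon>" .
  qed
qed

lemma exists_power_le:
  fixes \<kappa> :: real
  assumes "0 < \<kappa>"
  obtains \<Lambda> where "1 < \<Lambda>" "\<Lambda> ^ k \<le> 1 + \<kappa>"
proof -
  have "((\<lambda>x::real. x ^ k) \<longlongrightarrow> 1 ^ k) (at_right 1)" by (intro tendsto_intros)
  then have "\<forall>\<^sub>F x in at_right 1. x ^ k < 1 + \<kappa>"
    using assms by (intro order_tendstoD) auto
  then have "\<forall>\<^sub>F x in at_right 1. x ^ k < 1 + \<kappa> \<and> 1 < x"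
    by (intro eventually_conj eventually_at_right_less)
  then obtain x :: real where "x ^ k < 1 + \<kappa> \<and> 1 < x"
    using eventually_happens'[OF trivial_limit_at_right_real] by blast
  then show thesis by (intro that[of x]) auto
qed

text \<open>
  Convergence for nonnegative test functions. The comparison of levels is used in both directions,
  from \<open>r\<close> to a nearby \<open>s\<close> and back.
\<close>

lemma integral_parallel_surface_measure_tendsto_nonneg:
  fixes A :: "'a::euclidean_space set" and f :: "'a \<Rightarrow> real"
  assumes A: "compact A" "A \<noteq> {}" and r: "0 < r" and diff: "parallel_volume A differentiable (at r)"
    and f: "continuous_on UNIV f" "\<And>x. 0 \<le> f x" "\<And>x. f x \<le> M"
  shows "((\<lambda>s. \<integral>x. f x \<partial>parallel_surface_measure A s) \<longlongrightarrow> (\<integral>x. f x \<partial>parallel_surface_measure A r))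
    (at r within {0<..})"
proof (rule tendstoI)
  let ?k = "DIM('a) - 1"
  let ?H = "hausdorff_measure ?k :: 'a measure"
  define I where "I s = (\<integral>\<^sup>+x. ennreal (f x) * indicator (shell A s s) x \<partial>?H)" for s
  define j where "j s = (\<integral>x. f x \<partial>parallel_surface_measure A s)" for s
  have M: "0 \<le> M" using f(2,3)[of undefined] by linarith
  obtain a0 b0 B where ab0: "0 < a0" "a0 < r" "r < b0" and B: "0 \<le> B"
    and HB: "\<And>s. a0 < s \<Longrightarrow> s < b0 \<Longrightarrow> emeasure ?H (shell A s s) \<le> ennreal B"
    using level_measure_locally_bounded[OF A r diff] by blast
  have I_le: "I s \<le> ennreal (M * B)" if "a0 < s" "s < b0" for s
  proof -
    have "I s \<le> (\<integral>\<^sup>+x. ennreal M * indicator (shell A s s) x \<partial>?H)"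
      unfolding I_def using f(3) by (intro nn_integral_mono mult_right_mono ennreal_leI) auto
    also have "\<dots> = ennreal M * emeasure ?H (shell A s s)"
      using sets_shell[OF A] by (simp add: nn_integral_cmult_indicator)
    also have "\<dots> \<le> ennreal M * ennreal B" using HB[OF that] by (rule mult_left_mono) simp
    finally show ?thesis using M B by (simp add: ennreal_mult)
  qed
  have j: "I s = ennreal (j s)" "0 \<le> j s" "j s \<le> M * B" if "a0 < s" "s < b0" for s
  proof -
    have js: "j s = enn2real (I s)"
      unfolding j_def I_def using that ab0 by (intro integral_parallel_surface_measure A f) auto
    have "I s < top" using I_le[OF that] by (rule le_less_trans) simp
    then show "I s = ennreal (j s)" using js by simp
    then show "j s \<le> M * B" using I_le[OF that] M B by (simp add: ennreal_le_iff)
    show "0 \<le> j s" by (simp add: js)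
  qed
  fix \<epsilon> :: real assume \<epsilon>: "0 < \<epsilon>"
  define \<eta> where "\<eta> = \<epsilon> / 4 / (M + 1)"
  define e where "e = \<epsilon> / 4 / (B + 1)"
  define \<kappa> where "\<kappa> = \<epsilon> / 4 / (M * B + e * B + 1)"
  have cancel: "c / (x + 1) * (x + 1) = c" if "0 \<le> x" for c x :: real
    using that by simp
  have "\<eta> * (M + 1) = \<epsilon> / 4" "e * (B + 1) = \<epsilon> / 4"
    unfolding \<eta>_def e_def by (rule cancel[OF M], rule cancel[OF B])
  moreover have "0 < \<eta>" "0 < e" using M B \<epsilon> by (simp_all add: \<eta>_def e_def)
  ultimately have \<eta>: "0 < \<eta>" "M * \<eta> < \<epsilon> / 4" and e: "0 < e" "e * B < \<epsilon> / 4"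
    by (simp_all add: distrib_left mult.commute)
  have MB: "0 \<le> M * B + e * B" using M B e by (intro add_nonneg_nonneg mult_nonneg_nonneg) auto
  have \<kappa>: "0 < \<kappa>" using MB \<epsilon> by (simp add: \<kappa>_def)
  have \<kappa>': "\<kappa> * (M * B + e * B) < \<epsilon> / 4"
  proof -
    have "\<kappa> * (M * B + e * B) < \<kappa> * (M * B + e * B + 1)" using \<kappa> by (intro mult_strict_left_mono) auto
    also have "\<dots> = \<epsilon> / 4" unfolding \<kappa>_def by (rule cancel[OF MB])
    finally show ?thesis .
  qed
  obtain \<Lambda> where \<Lambda>: "1 < \<Lambda>" "\<Lambda> ^ ?k \<le> 1 + \<kappa>" using exists_power_le[OF \<kappa>] .
  obtain a1 t where at1: "0 < a1" "a1 < r" "r < t"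
    and small: "\<And>s. a1 < s \<Longrightarrow> s < t \<Longrightarrow> emeasure ?H (shell A s s - extendible A t s) \<le> ennreal \<eta>"
    using non_extendible_measure_small[OF A r diff \<eta>(1)] by blast
  have "uniformly_continuous_on (shell A 0 b0) f"
    using f(1) by (intro compact_uniformly_continuous compact_shell A) (rule continuous_on_subset, auto)
  then obtain \<delta> where \<delta>: "0 < \<delta>"
    and unif: "\<And>x y. x \<in> shell A 0 b0 \<Longrightarrow> y \<in> shell A 0 b0 \<Longrightarrow> dist y x < \<delta> \<Longrightarrow> dist (f y) (f x) < e"
    unfolding uniformly_continuous_on_def using e(1) by metis
  have step: "j s' < j s + \<epsilon>"
    if s: "a0 < s" "s < b0" "s < t" and s': "a0 < s'" "s' < b0" "a1 < s'" "s' < t"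
      and near: "\<bar>s' - s\<bar> < \<delta>" and ratio: "s' / s \<le> \<Lambda>" "(t - s') / (t - s) \<le> \<Lambda>" for s s'
  proof -
    have "I s' \<le> ennreal (\<Lambda> ^ ?k) * (I s + ennreal e * emeasure ?H (shell A s s))
        + ennreal M * emeasure ?H (shell A s' s' - extendible A t s')"
      unfolding I_def
    proof (rule nn_integral_level_le[OF A _ s(3) _ s'(4) f _ less_imp_le[OF e(1)] ratio])
      show "0 < s" "0 < s'" using s s' ab0 by auto
      fix x y assume xy: "x \<in> shell A s s" "y \<in> shell A s' s'" "dist x y \<le> \<bar>s' - s\<bar>"
      have "dist (f y) (f x) < e"
        using xy s s' ab0 near by (intro unif) (auto simp: shell_def dist_commute)
      then show "f y \<le> f x + e" by (simp add: dist_real_def)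
    qed
    also have "\<dots> \<le> ennreal (1 + \<kappa>) * (ennreal (j s) + ennreal e * ennreal B) + ennreal M * ennreal \<eta>"
      using HB[OF s(1,2)] small[OF s'(3,4)] \<Lambda>(2) unfolding j(1)[OF s(1,2)]
      by (intro add_mono mult_mono ennreal_leI) auto
    also have "\<dots> = ennreal ((1 + \<kappa>) * (j s + e * B) + M * \<eta>)"
      using \<kappa> j(2)[OF s(1,2)] e B M \<eta> by (simp add: ennreal_mult ennreal_plus)
    finally have "ennreal (j s') \<le> ennreal ((1 + \<kappa>) * (j s + e * B) + M * \<eta>)"
      unfolding j(1)[OF s'(1,2)] .
    moreover have "0 \<le> (1 + \<kappa>) * (j s + e * B) + M * \<eta>"
      using \<kappa> j(2)[OF s(1,2)] e B M \<eta> by simp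
    ultimately have "j s' \<le> (1 + \<kappa>) * (j s + e * B) + M * \<eta>"
      by (simp only: ennreal_le_iff)
    also have "\<dots> = j s + e * B + M * \<eta> + \<kappa> * (j s + e * B)" by (simp add: algebra_simps)
    finally have "j s' \<le> j s + e * B + M * \<eta> + \<kappa> * (j s + e * B)" .
    moreover have "\<kappa> * (j s + e * B) \<le> \<kappa> * (M * B + e * B)"
      using j(3)[OF s(1,2)] \<kappa> by (intro mult_left_mono) auto
    ultimately show ?thesis using \<eta>(2) e(2) \<kappa>' \<epsilon> by linarith
  qed
  have id: "((\<lambda>s. s) \<longlongrightarrow> r) (at r within {0<..})" by (rule tendsto_ident_at)
  have nr: "r \<noteq> 0" "t - r \<noteq> 0" using r at1 by auto
  have lims: "((\<lambda>s. s / r) \<longlongrightarrow> 1) (at r within {0<..})" "((\<lambda>s. r / s) \<longlongrightarrow> 1) (at r within {0<..})"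
    "((\<lambda>s. (t - s) / (t - r)) \<longlongrightarrow> 1) (at r within {0<..})"
    "((\<lambda>s. (t - r) / (t - s)) \<longlongrightarrow> 1) (at r within {0<..})"
    "((\<lambda>s. \<bar>s - r\<bar>) \<longlongrightarrow> 0) (at r within {0<..})"
    using nr by (auto intro!: tendsto_eq_intros id)
  have "\<forall>\<^sub>F s in at r within {0<..}. (a0 < s \<and> a1 < s \<and> s < b0 \<and> s < t) \<and>
      (s / r < \<Lambda> \<and> r / s < \<Lambda> \<and> (t - s) / (t - r) < \<Lambda> \<and> (t - r) / (t - s) < \<Lambda>) \<and> \<bar>s - r\<bar> < \<delta>"
    using ab0 at1 \<Lambda>(1) \<delta>
    by (intro eventually_conj order_tendstoD(1)[OF id] order_tendstoD(2)[OF id]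
        order_tendstoD(2)[OF lims(1)] order_tendstoD(2)[OF lims(2)] order_tendstoD(2)[OF lims(3)]
        order_tendstoD(2)[OF lims(4)] order_tendstoD(2)[OF lims(5)])
  then show "\<forall>\<^sub>F s in at r within {0<..}. dist (\<integral>x. f x \<partial>parallel_surface_measure A s)
      (\<integral>x. f x \<partial>parallel_surface_measure A r) < \<epsilon>"
  proof eventually_elim
    case (elim s)
    have "j s < j r + \<epsilon>" using elim ab0 at1 by (intro step) auto
    moreover have "j r < j s + \<epsilon>" using elim ab0 at1 by (intro step) auto
    ultimately show ?case by (simp add: j_def dist_real_def abs_less_iff)
  qed
qed

theorem theorem1p1:
  fixes A :: "'a::euclidean_space set" and r0 :: real
  assumes "A \<noteq> {}" and "compact A"
    and "r0 > 0"
    and "parallel_volume A differentiable (at r0 within {0<..})"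
  shows "weakly_converges (parallel_surface_measure A) (parallel_surface_measure A r0)
           (at r0 within {0<..})"
proof -
  let ?S = "parallel_surface_measure A"
  have diff: "parallel_volume A differentiable (at r0)"
    using assms(4) at_within_open[of r0 "{0<..}"] \<open>r0 > 0\<close> by simp
  note A = assms(2,1)
  obtain a b B where ab: "0 < a" "a < r0" "r0 < b" "0 \<le> B"
    and B: "\<And>s. a < s \<Longrightarrow> s < b \<Longrightarrow> emeasure (hausdorff_measure (DIM('a) - 1)) (shell A s s) \<le> ennreal B"
    using level_measure_locally_bounded[OF A assms(3) diff] by blast
  have fin: "finite_borel (?S s)" if "a < s" "s < b" for s
    using finite_borel_parallel_surface_measure[OF A _ B[OF that]] ab that by simp
  have ev: "\<forall>\<^sub>F s in at r0 within {0<..}. a < s \<and> s < b"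
    using ab by (intro eventually_conj order_tendstoD[OF tendsto_ident_at])
  show ?thesis unfolding weakly_converges_def
  proof (intro conjI allI impI)
    show "\<forall>\<^sub>F s in at r0 within {0<..}. finite_borel (?S s)"
      using ev by eventually_elim (simp add: fin)
    show "finite_borel (?S r0)" using ab by (intro fin)
    fix f :: "'a \<Rightarrow> real" assume f: "continuous_on UNIV f \<and> bounded (range f)"
    then obtain M where M: "\<And>x. \<bar>f x\<bar> \<le> M" unfolding bounded_iff by auto
    have M0: "0 \<le> M" using M[of undefined] by linarith
    \<comment> \<open>a bounded test function is the difference of two nonnegative ones, \<open>f + M\<close> and \<open>M\<close>\<close>
    have split: "(\<integral>x. f x + M \<partial>?S s) - (\<integral>x. M \<partial>?S s) = (\<integral>x. f x \<partial>?S s)" if "a < s" "s < b" for s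
    proof -
      interpret finite_measure "?S s" using fin[OF that] by (simp add: finite_borel_def)
      have "f \<in> borel_measurable (?S s)"
        using borel_measurable_continuous_onI[of f] f by (simp cong: measurable_cong_sets)
      then have "integrable (?S s) f"
        using M by (intro integrable_const_bound[of _ M]) auto
      then show ?thesis by (simp add: Bochner_Integration.integral_add)
    qed
    have "((\<lambda>s. \<integral>x. f x + M \<partial>?S s) \<longlongrightarrow> (\<integral>x. f x + M \<partial>?S r0)) (at r0 within {0<..})"
    proof (rule integral_parallel_surface_measure_tendsto_nonneg[OF A assms(3) diff])
      show "continuous_on UNIV (\<lambda>x. f x + M)" using f by (intro continuous_intros) auto
      show "0 \<le> f x + M" "f x + M \<le> 2 * M" for x using M[of x] by linarith+
    qed
    moreover have "((\<lambda>s. \<integral>x. M \<partial>?S s) \<longlongrightarrow> (\<integral>x. M \<partial>?S r0)) (at r0 within {0<..})"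
      using M0 by (intro integral_parallel_surface_measure_tendsto_nonneg[OF A assms(3) diff, of _ M]) auto
    ultimately have "((\<lambda>s. (\<integral>x. f x + M \<partial>?S s) - (\<integral>x. M \<partial>?S s))
        \<longlongrightarrow> (\<integral>x. f x + M \<partial>?S r0) - (\<integral>x. M \<partial>?S r0)) (at r0 within {0<..})"
      by (rule tendsto_diff)
    then have "((\<lambda>s. (\<integral>x. f x + M \<partial>?S s) - (\<integral>x. M \<partial>?S s)) \<longlongrightarrow> (\<integral>x. f x \<partial>?S r0)) (at r0 within {0<..})"
      unfolding split[OF ab(2,3)] .
    moreover have "\<forall>\<^sub>F s in at r0 within {0<..}. (\<integral>x. f x + M \<partial>?S s) - (\<integral>x. M \<partial>?S s) = (\<integral>x. f x \<partial>?S s)"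
      using ev by eventually_elim (simp only: split)
    ultimately show "((\<lambda>s. \<integral>x. f x \<partial>?S s) \<longlongrightarrow> (\<integral>x. f x \<partial>?S r0)) (at r0 within {0<..})"
      by (rule Lim_transform_eventually)
  qed
qed

end
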